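(* Let $p$ be a prime, let $m_1,m_2,m_3,n_1,n_2,n_3\in\mathbb{Z}_p$, let $\psi=\psi_{m_1,m_2,m_3}$ and $\psi'=\psi_{n_1,n_2,n_3}$ be the corresponding characters of $U(\mathbb{Q}_p)$ trivial on $U(\mathbb{Z}_p)$, where $U$ is the unipotent subgroup of $G=SO_{3,3}$ given in the context, and let $r,s\in\mathbb{Z}_{\geq 0}$. Then the local Kloosterman sums on $SO_{3,3}$ satisfy \begin{align*} \mathrm{Kl}_p(\psi,\psi';n_{\mathrm{id}}) &= 1, \\ \mathrm{Kl}_p(\psi,\psi';n_{s_\alpha,r}) &= S(m_2,n_2;p^r), \\ \mathrm{Kl}_p(\psi,\psi';n_{s_\beta,r}) &= S(m_1,n_1;p^r), \\ \mathrm{Kl}_p(\psi,\psi';n_{s_\gamma,r}) &= S(m_3,n_3;p^r), \\ \mathrm{Kl}_p(\psi,\psi';n_{s_\alpha s_\beta,r,s}) &= S_3(-n_1,m_1,m_2;p^r,p^s)\quad\text{if } r\leq s, \\ \mathrm{Kl}_p(\psi,\psi';n_{s_\alpha s_\gamma,r,s}) &= S(m_2,n_2;p^s)\,S(m_3,n_3;p^r), \\ \mathrm{Kl}_p(\psi,\psi';n_{s_\beta s_\alpha,r,s}) &= S_3(-n_2,m_2,m_1;p^s,p^r)\quad\text{if } r\geq s, \\ \mathrm{Kl}_p(\psi,\psi';n_{s_\beta s_\gamma,r,s}) &= S_3(n_3,m_3,m_1;p^s,p^r)\quad\text{if } r\geq s,\\ \mathrm{Kl}_p(\psi,\psi';n_{s_\gamma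 s_\beta,r,s}) &= S_3(-n_1,m_1,m_3;p^r,p^s)\quad\text{if } r\leq s. \end{align*}
   Context: Group. $SO_{3,3}=\{A\in GL_6 : AMA^t=M,\ \det A=1\}$ with $M=\begin{pmatrix}0&I_3\\ I_3&0\end{pmatrix}$. For a subgroup $H$ of $SO_{3,3}$, $H(\mathbb{Z}_p)$ denotes the matrices in $H(\mathbb{Q}_p)$ lying in $SO_{3,3}(\mathbb{Z}_p)$ (entries in $\mathbb{Z}_p$). The maximal torus is $T=\{\mathrm{diag}(t_1,t_2,t_3,t_1^{-1},t_2^{-1},t_3^{-1})\}$, with normalizer $N$, and $$U=\left\{\begin{pmatrix} 1 & x & y & -xz-yt & z & t \\ 0 & 1 & u & -z-yv-tu+uvx & -uv & v \\ 0 & 0 & 1 & -t+xv & -v & 0\\ 0&0&0& 1 &0 &0 \\ 0&0&0& -x & 1 & 0\\ 0&0&0& xu-y & -u & 1 \end{pmatrix}\right\},$$ the unipotent subgroup for the positive roots $\alpha_1\pm\alpha_2,\alpha_1\pm\alpha_3,\alpha_2\pm\alpha_3$ (where $\alpha_i$ sends the torus element to $t_i$). $U^-$ is the unipotent subgroup for the negative roots, i.e. the transposes of the elements of $U$. Kloosterman sums. For $n\in N(\mathbb{Q}_p)$ put $U^{\overline n}=U\cap n^{-1}U^-n$ and $$X(n)=U(\mathbb{Z}_p)\backslash\big(U(\mathbb{Q}_p)\,n\,U^{\overline n}(\mathbb{Q}_p)\cap G(\mathbb{Z}_p)\big)/U^{\overline n}(\mathbb{Z}_p),\qquad G=SO_{3,3}.$$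 By uniqueness of the Bruhat decomposition there are maps $u:X(n)\to U(\mathbb{Z}_p)\backslash U(\mathbb{Q}_p)$ and $u':X(n)\to U^{\overline n}(\mathbb{Q}_p)/U^{\overline n}(\mathbb{Z}_p)$ with $x=u(x)\,n\,u'(x)$. For characters $\psi,\psi':U(\mathbb{Q}_p)\to\mathbb{C}^\times$ trivial on $U(\mathbb{Z}_p)$, $$\mathrm{Kl}_p(\psi,\psi';n)=\sum_{x\in X(n)}\psi(u(x))\,\psi'(u'(x)).$$ Characters. $e(x)=\exp(2\pi i x)$, extended to $x\in\mathbb{Q}_p$ via $\mathbb{Q}_p/\mathbb{Z}_p\cong\mathbb{Z}[1/p]/\mathbb{Z}$ (so $e$ is trivial on $\mathbb{Z}_p$). For $m_1,m_2,m_3\in\mathbb{Z}_p$ and $A=(a_{ij})\in U(\mathbb{Q}_p)$, $\psi_{m_1,m_2,m_3}(A)=e(m_1a_{12}+m_2a_{23}+m_3a_{26})$. Elements of $N(\mathbb{Q}_p)$. With $E_{ij}$ the $6\times 6$ matrix units: $n_{\mathrm{id}}=I_6$; $n_{s_\alpha,r}=E_{11}+p^{-r}E_{23}-p^{r}E_{32}+E_{44}+p^{r}E_{56}-p^{-r}E_{65}$; $n_{s_\beta,r}=p^{-r}E_{12}-p^{r}E_{21}+E_{33}+p^{r}E_{45}-p^{-r}E_{54}+E_{66}$; $n_{s_\gamma,r}=E_{11}-p^{-r}E_{26}+p^{-r}E_{35}+E_{44}-p^{r}E_{53}+p^{r}E_{62}$; $n_{s_\alpha s_\beta,r,s}=p^{-r}E_{12}+p^{r-s}E_{23}+p^{s}E_{31}+p^{r}E_{45}+p^{s-r}E_{56}+p^{-s}E_{64}$;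 $n_{s_\alpha s_\gamma,r,s}=E_{11}-p^{-r-s}E_{25}-p^{s-r}E_{36}+E_{44}-p^{r+s}E_{52}-p^{r-s}E_{63}$; $n_{s_\beta s_\alpha,r,s}=p^{-r}E_{13}-p^{r-s}E_{21}-p^{s}E_{32}+p^{r}E_{46}-p^{s-r}E_{54}-p^{-s}E_{65}$; $n_{s_\beta s_\gamma,r,s}=p^{-r}E_{16}+p^{r-s}E_{21}+p^{-s}E_{35}+p^{r}E_{43}+p^{s-r}E_{54}+p^{s}E_{62}$; $n_{s_\gamma s_\beta,r,s}=p^{-r}E_{12}-p^{r-s}E_{26}+p^{-s}E_{34}+p^{r}E_{45}-p^{s-r}E_{53}+p^{s}E_{61}$. Exponential sums. For $m,n\in\mathbb{Z}_p$, $S(m,n;p^r)=\sum_{d\,(\mathrm{mod}\,p^r),\,(d,p^r)=1}e\left(\frac{m\overline d+nd}{p^r}\right)$ with $d\overline d\equiv1\ (\mathrm{mod}\ p^r)$. For $m_1,n_1,n_2\in\mathbb{Z}_p$ and integers $0\leq r\leq s$, $$S_3(m_1,n_1,n_2;p^r,p^s)=\sum_{\substack{x\,(\mathrm{mod}\,p^r)\\(x,p^r)=1}}\ \sum_{\substack{y\,(\mathrm{mod}\,p^s)\\(y,p^{s-r})=1}}e\left(\frac{m_1x+n_1\overline{x}y}{p^r}\right)e\left(\frac{n_2\overline{y}}{p^{s-r}}\right),$$ with $x\overline x\equiv1\ (\mathrm{mod}\ p^r)$ and $y\overline y\equiv1\ (\mathrm{mod}\ p^{s-r})$. *)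

theory Defs
  imports
    "HOL-Analysis.Analysis"
    "HOL-Computational_Algebra.Fraction_Field"
    "HOL-Number_Theory.Modular_Inverse"
    "Berlekamp_Zassenhaus.Finite_Field"
begin

section \<open>The p-adic integers and the p-adic numbers\<close>

text \<open>
  The prime is the cardinality of a type \<open>'p\<close> of class \<open>prime_card\<close>, and the ring of p-adic
  integers is the inverse limit of the rings of integers modulo \<open>p ^ n\<close>: an element is the
  sequence of its residues in \<open>{0..<p ^ n}\<close>.
\<close>

typedef (overloaded) 'p padic_int =
  "{f :: nat \<Rightarrow> int. \<forall>n. f n = f (Suc n) mod int CARD('p::prime_card) ^ n}"
  morphisms padic_res Abs_padic_int
  by (rule exI[of _ "\<lambda>_. 0"]) simp

setup_lifting type_definition_padic_int

lemma coherent_mod_self: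
  assumes "\<forall>n. f n = f (Suc n) mod (p::int) ^ n"
  shows "f n mod p ^ n = f n"
  by (metis assms mod_mod_trivial)

lemma coherent_mod_le:
  assumes "\<forall>n. f n = f (Suc n) mod (p::int) ^ n" "m \<le> n"
  shows "f n mod p ^ m = f m"
  using assms(2)
proof (induction n rule: dec_induct)
  case base
  show ?case by (rule coherent_mod_self[OF assms(1)])
next
  case (step n)
  have "f (Suc n) mod p ^ m = f (Suc n) mod p ^ n mod p ^ m"
    using step.hyps by (simp add: le_imp_power_dvd mod_mod_cancel)
  with step assms(1) show ?case by metis
qed

lemma mod_mod_power_Suc: "(x::int) mod p ^ Suc n mod p ^ n = x mod p ^ n"
  by (rule mod_mod_cancel) (simp add: le_imp_power_dvd)

instantiation padic_int :: (prime_card) comm_ring_1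
begin

lift_definition zero_padic_int :: "'a padic_int" is "\<lambda>_. 0" by simp

lift_definition one_padic_int :: "'a padic_int" is "\<lambda>n. 1 mod int CARD('a) ^ n"
  by (simp only: mod_mod_power_Suc simp_thms)

lift_definition plus_padic_int :: "'a padic_int \<Rightarrow> 'a padic_int \<Rightarrow> 'a padic_int"
  is "\<lambda>f g n. (f n + g n) mod int CARD('a) ^ n"
proof -
  fix f g :: "nat \<Rightarrow> int" and n
  assume f: "\<And>n. f n = f (Suc n) mod int CARD('a) ^ n"
    and g: "\<And>n. g n = g (Suc n) mod int CARD('a) ^ n"
  show "(f n + g n) mod int CARD('a) ^ n =
      (f (Suc n) + g (Suc n)) mod int CARD('a) ^ Suc n mod int CARD('a) ^ n"
    unfolding mod_mod_power_Suc f[of n] g[of n] by (simp only: mod_simps)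
qed

lift_definition uminus_padic_int :: "'a padic_int \<Rightarrow> 'a padic_int"
  is "\<lambda>f n. (- f n) mod int CARD('a) ^ n"
proof -
  fix f :: "nat \<Rightarrow> int" and n
  assume f: "\<And>n. f n = f (Suc n) mod int CARD('a) ^ n"
  show "(- f n) mod int CARD('a) ^ n = (- f (Suc n)) mod int CARD('a) ^ Suc n mod int CARD('a) ^ n"
    unfolding mod_mod_power_Suc f[of n] by (simp only: mod_simps)
qed

lift_definition minus_padic_int :: "'a padic_int \<Rightarrow> 'a padic_int \<Rightarrow> 'a padic_int"
  is "\<lambda>f g n. (f n - g n) mod int CARD('a) ^ n"
proof -
  fix f g :: "nat \<Rightarrow> int" and n
  assume f: "\<And>n. f n = f (Suc n) mod int CARD('a) ^ n"
    and g: "\<And>n. g n = g (Suc n) mod int CARD('a) ^ n"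
  show "(f n - g n) mod int CARD('a) ^ n =
      (f (Suc n) - g (Suc n)) mod int CARD('a) ^ Suc n mod int CARD('a) ^ n"
    unfolding mod_mod_power_Suc f[of n] g[of n] by (simp only: mod_simps)
qed

lift_definition times_padic_int :: "'a padic_int \<Rightarrow> 'a padic_int \<Rightarrow> 'a padic_int"
  is "\<lambda>f g n. (f n * g n) mod int CARD('a) ^ n"
proof -
  fix f g :: "nat \<Rightarrow> int" and n
  assume f: "\<And>n. f n = f (Suc n) mod int CARD('a) ^ n"
    and g: "\<And>n. g n = g (Suc n) mod int CARD('a) ^ n"
  show "(f n * g n) mod int CARD('a) ^ n =
      (f (Suc n) * g (Suc n)) mod int CARD('a) ^ Suc n mod int CARD('a) ^ n"
    unfolding mod_mod_power_Suc f[of n] g[of n] by (simp only: mod_simps)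
qed

instance
proof
  fix a b c :: "'a padic_int"
  have res_mod: "padic_res x n mod int CARD('a) ^ n = padic_res x n" for x :: "'a padic_int" and n
    by (rule coherent_mod_self) (use padic_res[of x] in blast)
  note res_simps = padic_res_inject[symmetric] fun_eq_iff zero_padic_int.rep_eq one_padic_int.rep_eq
    plus_padic_int.rep_eq uminus_padic_int.rep_eq minus_padic_int.rep_eq times_padic_int.rep_eq
    mod_simps res_mod
  show "a + b + c = a + (b + c)" by (simp add: res_simps add.assoc)
  show "a + b = b + a" by (simp add: res_simps add.commute)
  show "0 + a = a" by (simp add: res_simps)
  show "- a + a = 0" by (simp add: res_simps)
  show "a - b = a + - b" by (simp add: res_simps)
  show "a * b * c = a * (b * c)" by (simp add: res_simps mult.assoc)
  show "a * b = b * a" by (simp add: res_simps mult.commute)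
  show "1 * a = a" by (simp add: res_simps)
  show "(a + b) * c = a * c + b * c" by (simp add: res_simps distrib_right)
  have "(1::int) mod int CARD('a) ^ 1 \<noteq> 0"
    using prime_gt_1_nat[OF prime_card[where 'a = 'a]] by simp
  then have "padic_res (0 :: 'a padic_int) 1 \<noteq> padic_res 1 1"
    by (simp add: zero_padic_int.rep_eq one_padic_int.rep_eq)
  then show "(0 :: 'a padic_int) \<noteq> 1" by auto
qed

end

instance padic_int :: (prime_card) idom
proof
  fix a b :: "'a padic_int"
  let ?p = "int CARD('a)"
  have p: "prime ?p" by (rule prime_card_int)
  assume "a \<noteq> 0" "b \<noteq> 0"
  then show "a * b \<noteq> 0"
  proof transfer
    fix f g :: "nat \<Rightarrow> int"
    assume f: "\<forall>n. f n = f (Suc n) mod ?p ^ n" and g: "\<forall>n. g n = g (Suc n) mod ?p ^ n"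
    assume "f \<noteq> (\<lambda>_. 0)" "g \<noteq> (\<lambda>_. 0)"
    then obtain i j where ij: "f i \<noteq> 0" "g j \<noteq> 0" by (auto simp: fun_eq_iff)
    have nd: "\<not> ?p ^ i dvd f (i + j)" "\<not> ?p ^ j dvd g (i + j)"
      using coherent_mod_le[OF f, of i "i + j"] coherent_mod_le[OF g, of j "i + j"] ij
      by (simp_all add: dvd_eq_mod_eq_0)
    then have nz: "f (i + j) \<noteq> 0" "g (i + j) \<noteq> 0" by (metis dvd_0_right)+
    have "multiplicity ?p (f (i + j)) < i" "multiplicity ?p (g (i + j)) < j"
      using nd multiplicity_dvd' by (metis not_le)+
    then have "multiplicity ?p (f (i + j) * g (i + j)) < i + j"
      using p nz by (simp add: prime_elem_multiplicity_mult_distrib)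
    moreover have "i + j \<le> multiplicity ?p (f (i + j) * g (i + j))"
      if "?p ^ (i + j) dvd f (i + j) * g (i + j)"
      by (rule multiplicity_geI) (use that nz p not_prime_unit in auto)
    ultimately have "\<not> ?p ^ (i + j) dvd f (i + j) * g (i + j)"
      using not_le by blast
    then have "f (i + j) * g (i + j) mod ?p ^ (i + j) \<noteq> 0"
      by (simp only: dvd_eq_mod_eq_0 not_False_eq_True)
    then show "(\<lambda>n. f n * g n mod ?p ^ n) \<noteq> (\<lambda>_. 0)"
      by (auto simp only: fun_eq_iff)
  qed
qed

type_synonym 'p padic = "'p padic_int fract"

definition of_padic_int :: "'p::prime_card padic_int \<Rightarrow> 'p padic" where
  "of_padic_int a = Fract a 1"

definition padic_ints :: "'p::prime_card padic set" where
  "padic_ints = range of_padic_int"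

definition p_pow :: "int \<Rightarrow> 'p::prime_card padic" where
  "p_pow k = of_nat CARD('p) powi k"


section \<open>Additive characters and exponential sums\<close>

definition e_real :: "real \<Rightarrow> complex" where
  "e_real x = exp (2 * of_real pi * \<i> * of_real x)"

text \<open>
  The extension of \<^const>\<open>e_real\<close> to the p-adic numbers: the value at \<open>x\<close> is the value at any
  \<open>a / p ^ k\<close> that differs from \<open>x\<close> by a p-adic integer.
\<close>

definition e_padic :: "'p::prime_card padic \<Rightarrow> complex" where
  "e_padic x = (THE z. \<exists>(a::int) (k::nat).
     x - of_int a / of_nat (CARD('p) ^ k) \<in> padic_ints \<and>
     z = e_real (of_int a / of_nat (CARD('p) ^ k)))"

text \<open>\<open>kl_S m n r\<close> is the classical Kloosterman sum of modulus \<open>p ^ r\<close>.\<close>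

definition kl_S :: "'p::prime_card padic_int \<Rightarrow> 'p padic_int \<Rightarrow> nat \<Rightarrow> complex" where
  "kl_S m n r = (let q = int CARD('p) ^ r in
     \<Sum>d | d \<in> {0..<q} \<and> coprime d q.
       e_padic ((of_padic_int m * of_int (modular_inverse q d) + of_padic_int n * of_int d)
                / of_int q))"

text \<open>\<open>kl_S3 m1 n1 n2 r s\<close> has the moduli \<open>p ^ r\<close> and \<open>p ^ s\<close>; it is meant for \<open>r \<le> s\<close>.\<close>

definition kl_S3 :: "'p::prime_card padic_int \<Rightarrow> 'p padic_int \<Rightarrow> 'p padic_int \<Rightarrow> nat \<Rightarrow> nat \<Rightarrow> complex"
where
  "kl_S3 m1 n1 n2 r s =
    (let P = int CARD('p) ^ r; Q = int CARD('p) ^ s; D = int CARD('p) ^ (s - r) in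
     \<Sum>x | x \<in> {0..<P} \<and> coprime x P. \<Sum>y | y \<in> {0..<Q} \<and> coprime y D.
       e_padic ((of_padic_int m1 * of_int x
                 + of_padic_int n1 * of_int (modular_inverse P x) * of_int y) / of_int P) *
       e_padic (of_padic_int n2 * of_int (modular_inverse D y) / of_int D))"


section \<open>The group and its unipotent subgroups\<close>

text \<open>
  Matrix indices are in the type \<open>6\<close>, whose elements are \<open>1, \<dots>, 5\<close> and \<open>6 = 0\<close>;
  \<^const>\<open>vector\<close> numbers the entries of its list argument from \<open>1\<close>.
\<close>

definition SO33_form :: "'a::comm_ring_1 ^ 6 ^ 6" where
  "SO33_form = vector
    [vector [0, 0, 0, 1, 0, 0],
     vector [0, 0, 0, 0, 1, 0],
     vector [0, 0, 0, 0, 0, 1],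
     vector [1, 0, 0, 0, 0, 0],
     vector [0, 1, 0, 0, 0, 0],
     vector [0, 0, 1, 0, 0, 0]]"

definition SO33 :: "('a::comm_ring_1 ^ 6 ^ 6) set" where
  "SO33 = {A. A ** SO33_form ** transpose A = SO33_form \<and> det A = 1}"

definition integral_points :: "('p::prime_card padic ^ 6 ^ 6) set \<Rightarrow> ('p padic ^ 6 ^ 6) set" where
  "integral_points H = {A \<in> H. A \<in> SO33 \<and> (\<forall>i j. A $ i $ j \<in> padic_ints)}"

definition U33_mat :: "'a::comm_ring_1 \<Rightarrow> 'a \<Rightarrow> 'a \<Rightarrow> 'a \<Rightarrow> 'a \<Rightarrow> 'a \<Rightarrow> 'a ^ 6 ^ 6" where
  "U33_mat x y z t u v = vector
    [vector [1, x, y, - x * z - y * t, z, t],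
     vector [0, 1, u, - z - y * v - t * u + u * v * x, - u * v, v],
     vector [0, 0, 1, - t + x * v, - v, 0],
     vector [0, 0, 0, 1, 0, 0],
     vector [0, 0, 0, - x, 1, 0],
     vector [0, 0, 0, x * u - y, - u, 1]]"

definition U33 :: "('a::comm_ring_1 ^ 6 ^ 6) set" where
  "U33 = {U33_mat x y z t u v | x y z t u v. True}"

definition U33_minus :: "('a::comm_ring_1 ^ 6 ^ 6) set" where
  "U33_minus = transpose ` U33"

definition U33_bar :: "'a::field ^ 6 ^ 6 \<Rightarrow> ('a ^ 6 ^ 6) set" where
  "U33_bar n = U33 \<inter> (\<lambda>a. matrix_inv n ** a ** n) ` U33_minus"


section \<open>Local Kloosterman sums\<close>

definition set_mult :: "('a::semiring_1 ^ 6 ^ 6) set \<Rightarrow> ('a ^ 6 ^ 6) set \<Rightarrow> ('a ^ 6 ^ 6) set"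
  (infixl \<open>\<cdot>\<close> 75) where
  "A \<cdot> B = {a ** b | a b. a \<in> A \<and> b \<in> B}"

definition kl_X :: "'p::prime_card padic ^ 6 ^ 6 \<Rightarrow> ('p padic ^ 6 ^ 6) set set" where
  "kl_X n = (\<lambda>g. integral_points U33 \<cdot> {g} \<cdot> integral_points (U33_bar n)) `
     (U33 \<cdot> {n} \<cdot> U33_bar n \<inter> integral_points SO33)"

text \<open>
  The pair of the coset \<open>u(x)\<close> of \<open>U33(Z_p)\<close> in \<open>U33(Q_p)\<close> and the coset \<open>u'(x)\<close> of the integral
  points of \<open>U33_bar n\<close> in \<open>U33_bar n\<close> with \<open>x = u(x) n u'(x)\<close>.
\<close>

definition bruhat_pair ::
  "'p::prime_card padic ^ 6 ^ 6 \<Rightarrow> ('p padic ^ 6 ^ 6) set \<Rightarrow>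
   ('p padic ^ 6 ^ 6) set \<times> ('p padic ^ 6 ^ 6) set" where
  "bruhat_pair n x = (THE (C, D).
     C \<in> (\<lambda>a. integral_points U33 \<cdot> {a}) ` U33 \<and>
     D \<in> (\<lambda>b. {b} \<cdot> integral_points (U33_bar n)) ` U33_bar n \<and>
     x = C \<cdot> {n} \<cdot> D)"

definition bruhat_u where "bruhat_u n x = fst (bruhat_pair n x)"

definition bruhat_u' where "bruhat_u' n x = snd (bruhat_pair n x)"

text \<open>
  A character that is trivial on the integral points is constant on the cosets \<open>u(x)\<close>, \<open>u'(x)\<close>;
  its value on a coset is the element of the singleton image.
\<close>

definition kl_sum ::
  "('p::prime_card padic ^ 6 ^ 6 \<Rightarrow> complex) \<Rightarrow> ('p padic ^ 6 ^ 6 \<Rightarrow> complex) \<Rightarrow>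
   'p padic ^ 6 ^ 6 \<Rightarrow> complex" where
  "kl_sum \<psi> \<psi>' n =
     (\<Sum>x\<in>kl_X n. the_elem (\<psi> ` bruhat_u n x) * the_elem (\<psi>' ` bruhat_u' n x))"

definition U33_char ::
  "'p::prime_card padic_int \<Rightarrow> 'p padic_int \<Rightarrow> 'p padic_int \<Rightarrow> 'p padic ^ 6 ^ 6 \<Rightarrow> complex" where
  "U33_char m1 m2 m3 A =
     e_padic (of_padic_int m1 * A $ 1 $ 2 + of_padic_int m2 * A $ 2 $ 3 + of_padic_int m3 * A $ 2 $ 6)"


section \<open>Representatives in the normalizer of the torus\<close>

text \<open>
  \<open>E_mat c i j\<close> is \<open>c\<close> times the matrix unit at row \<open>i\<close> and column \<open>j\<close>. The suffixes \<open>a\<close>, \<open>b\<close>, \<open>c\<close>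
  of the representatives stand for the simple reflections in \<open>\<alpha> = \<alpha>\<^sub>2 - \<alpha>\<^sub>3\<close>, \<open>\<beta> = \<alpha>\<^sub>1 - \<alpha>\<^sub>2\<close> and
  \<open>\<gamma> = \<alpha>\<^sub>2 + \<alpha>\<^sub>3\<close>.
\<close>

definition E_mat :: "'a::zero \<Rightarrow> 6 \<Rightarrow> 6 \<Rightarrow> 'a ^ 6 ^ 6" where
  "E_mat c i j = (\<chi> k l. if k = i \<and> l = j then c else 0)"

definition n_id :: "'p::prime_card padic ^ 6 ^ 6" where
  "n_id = mat 1"

definition n_a :: "int \<Rightarrow> 'p::prime_card padic ^ 6 ^ 6" where
  "n_a r = E_mat 1 1 1 + E_mat (p_pow (- r)) 2 3 - E_mat (p_pow r) 3 2
         + E_mat 1 4 4 + E_mat (p_pow r) 5 6 - E_mat (p_pow (- r)) 6 5"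

definition n_b :: "int \<Rightarrow> 'p::prime_card padic ^ 6 ^ 6" where
  "n_b r = E_mat (p_pow (- r)) 1 2 - E_mat (p_pow r) 2 1 + E_mat 1 3 3
         + E_mat (p_pow r) 4 5 - E_mat (p_pow (- r)) 5 4 + E_mat 1 6 6"

definition n_c :: "int \<Rightarrow> 'p::prime_card padic ^ 6 ^ 6" where
  "n_c r = E_mat 1 1 1 - E_mat (p_pow (- r)) 2 6 + E_mat (p_pow (- r)) 3 5
         + E_mat 1 4 4 - E_mat (p_pow r) 5 3 + E_mat (p_pow r) 6 2"

definition n_ab :: "int \<Rightarrow> int \<Rightarrow> 'p::prime_card padic ^ 6 ^ 6" where
  "n_ab r s = E_mat (p_pow (- r)) 1 2 + E_mat (p_pow (r - s)) 2 3 + E_mat (p_pow s) 3 1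
            + E_mat (p_pow r) 4 5 + E_mat (p_pow (s - r)) 5 6 + E_mat (p_pow (- s)) 6 4"

definition n_ac :: "int \<Rightarrow> int \<Rightarrow> 'p::prime_card padic ^ 6 ^ 6" where
  "n_ac r s = E_mat 1 1 1 - E_mat (p_pow (- r - s)) 2 5 - E_mat (p_pow (s - r)) 3 6
            + E_mat 1 4 4 - E_mat (p_pow (r + s)) 5 2 - E_mat (p_pow (r - s)) 6 3"

definition n_ba :: "int \<Rightarrow> int \<Rightarrow> 'p::prime_card padic ^ 6 ^ 6" where
  "n_ba r s = E_mat (p_pow (- r)) 1 3 - E_mat (p_pow (r - s)) 2 1 - E_mat (p_pow s) 3 2
            + E_mat (p_pow r) 4 6 - E_mat (p_pow (s - r)) 5 4 - E_mat (p_pow (- s)) 6 5"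

definition n_bc :: "int \<Rightarrow> int \<Rightarrow> 'p::prime_card padic ^ 6 ^ 6" where
  "n_bc r s = E_mat (p_pow (- r)) 1 6 + E_mat (p_pow (r - s)) 2 1 + E_mat (p_pow (- s)) 3 5
            + E_mat (p_pow r) 4 3 + E_mat (p_pow (s - r)) 5 4 + E_mat (p_pow s) 6 2"

definition n_cb :: "int \<Rightarrow> int \<Rightarrow> 'p::prime_card padic ^ 6 ^ 6" where
  "n_cb r s = E_mat (p_pow (- r)) 1 2 - E_mat (p_pow (r - s)) 2 6 + E_mat (p_pow (- s)) 3 4
            + E_mat (p_pow r) 4 5 - E_mat (p_pow (s - r)) 5 3 + E_mat (p_pow s) 6 1"

end

theory Submission
  imports Defs
begin

text \<open>
  The coset space \<open>X(n)\<close> is parametrised by its right factor. If \<open>u n w\<close> and \<open>u' n w\<close> are both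
  integral then \<open>u' u\<inverse>\<close> is integral, so for \<open>w\<close> in \<open>U33_bar n\<close> the coset \<open>U(Z_p) u\<close> is determined by
  \<open>w\<close>. Hence \<open>X(n)\<close> is the set of those \<open>w\<close>, modulo integral right factors, for which some \<open>u\<close>
  makes \<open>u n w\<close> integral, and the Kloosterman sum is the sum of \<open>\<psi>(u) \<psi>'(w)\<close> over them. The
  predicate \<open>bruhat_reps\<close> says that a family of pairs \<open>(u, w)\<close> represents \<open>X(n)\<close> in this way, and
  \<open>kl_sum_eq_sum_reps\<close> turns such a family into the value of the sum.

  It remains to find the families. The group \<open>U33_bar n\<close> contains one parameter for each positive
  root that \<open>n\<close> makes negative, so at most two. If \<open>g = u n w\<close> is integral, then parts of some
  rows of \<open>g\<close> are rows of \<open>w\<close> times powers of \<open>p\<close>; this bounds the denominators of the parameters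
  of \<open>w\<close>. The rows of \<open>g\<close> are also primitive, because \<open>g\<close> preserves the form and the pairing of row \<open>i\<close> with
  its dual row is \<open>1\<close>; this forces the coprimality conditions. Conversely, for parameters that
  satisfy these conditions a matrix \<open>u\<close> is written down from inverses modulo powers of \<open>p\<close>, and
  \<open>u n w\<close> is computed. The entries of \<open>u\<close> that the character sees are built from these inverses,
  as are the terms of the classical sums.

  This is done for \<open>n_a\<close>, \<open>n_b\<close>, \<open>n_ab\<close>, \<open>n_ba\<close>, and for \<open>n_ac\<close>, where the conditions come from
  two by two minors instead of single rows. The elements \<open>n_c\<close>, \<open>n_bc\<close>, \<open>n_cb\<close> are
  obtained from \<open>n_a\<close>, \<open>n_ba\<close>, \<open>n_ab\<close> by the outer automorphism of the group that exchanges the third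
  and the sixth coordinate, up to signs. It exchanges the simple roots \<open>\<alpha>\<close> and \<open>\<gamma>\<close>.
\<close>

section \<open>Residues and divisibility in the p-adic integers\<close>

abbreviation pp :: "'p::prime_card padic" where
  "pp \<equiv> of_nat CARD('p)"

lemma of_padic_int_hom:
  "of_padic_int 0 = 0" "of_padic_int 1 = 1"
  "of_padic_int (a + b) = of_padic_int a + of_padic_int b"
  "of_padic_int (a * b) = of_padic_int a * of_padic_int b"
  "of_padic_int (- a) = - of_padic_int a"
  "of_padic_int (a - b) = of_padic_int a - of_padic_int b"
  by (simp_all add: of_padic_int_def Zero_fract_def One_fract_def)

lemma of_padic_int_of_nat [simp]: "of_padic_int (of_nat n) = of_nat n"
  by (induction n) (simp_all add: of_padic_int_hom)

lemma of_padic_int_of_int [simp]: "of_padic_int (of_int n) = of_int n"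
  by (cases n rule: int_diff_cases) (simp add: of_padic_int_hom)

lemma of_padic_int_power [simp]: "of_padic_int (a ^ n) = of_padic_int a ^ n"
  by (induction n) (simp_all add: of_padic_int_hom)

lemma of_padic_int_inject [simp]: "of_padic_int a = of_padic_int b \<longleftrightarrow> a = b"
  by (simp add: of_padic_int_def eq_fract)

lemma of_padic_int_in [simp]: "of_padic_int a \<in> padic_ints"
  by (simp add: padic_ints_def)

lemma padic_ints_0 [simp]: "0 \<in> padic_ints"
  and padic_ints_1 [simp]: "1 \<in> padic_ints"
  by (metis of_padic_int_hom(1) of_padic_int_in, metis of_padic_int_hom(2) of_padic_int_in)

lemma padic_ints_add [simp, intro]: "x \<in> padic_ints \<Longrightarrow> y \<in> padic_ints \<Longrightarrow> x + y \<in> padic_ints"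
  and padic_ints_mult [simp, intro]: "x \<in> padic_ints \<Longrightarrow> y \<in> padic_ints \<Longrightarrow> x * y \<in> padic_ints"
  and padic_ints_diff [simp, intro]: "x \<in> padic_ints \<Longrightarrow> y \<in> padic_ints \<Longrightarrow> x - y \<in> padic_ints"
  unfolding padic_ints_def by (auto simp flip: of_padic_int_hom)

lemma padic_ints_minus_iff [simp]: "- x \<in> padic_ints \<longleftrightarrow> x \<in> padic_ints"
  by (metis padic_ints_0 padic_ints_diff diff_0 minus_minus)

lemma padic_ints_of_int [simp]: "of_int n \<in> padic_ints"
  by (metis of_padic_int_of_int of_padic_int_in)

lemma padic_ints_of_nat [simp]: "of_nat n \<in> padic_ints"
  by (metis of_padic_int_of_nat of_padic_int_in)

lemma padic_ints_power [simp, intro]: "x \<in> padic_ints \<Longrightarrow> x ^ n \<in> padic_ints"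
  by (induction n) auto

lemma padic_ints_sum [simp, intro]: "(\<And>i. i \<in> I \<Longrightarrow> f i \<in> padic_ints) \<Longrightarrow> sum f I \<in> padic_ints"
  by (induction I rule: infinite_finite_induct) auto

lemma padic_res_of_nat: "padic_res (of_nat m :: 'p::prime_card padic_int) n = int m mod int CARD('p) ^ n"
  by (induction m)
    (simp_all add: zero_padic_int.rep_eq one_padic_int.rep_eq plus_padic_int.rep_eq mod_simps)

lemma padic_res_of_int: "padic_res (of_int m :: 'p::prime_card padic_int) n = m mod int CARD('p) ^ n"
  by (cases m rule: int_diff_cases) (simp add: minus_padic_int.rep_eq padic_res_of_nat mod_simps)

lemma of_int_padic_eq_0_iff [simp]: "(of_int m :: 'p::prime_card padic) = 0 \<longleftrightarrow> m = 0"
proof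
  assume "(of_int m :: 'p padic) = 0"
  then have "of_padic_int (of_int m :: 'p padic_int) = of_padic_int 0"
    by (simp add: of_padic_int_hom)
  then have "padic_res (of_int m :: 'p padic_int) = padic_res (0 :: 'p padic_int)"
    by (simp only: of_padic_int_inject)
  then have *: "m mod int CARD('p) ^ n = 0" for n
    by (metis padic_res_of_int zero_padic_int.rep_eq)
  \<comment> \<open>At level \<open>k = \<bar>m\<bar>\<close> the modulus already exceeds \<open>\<bar>m\<bar>\<close>, so a nonzero \<open>m\<close> is not divisible by it.\<close>
  have "\<bar>m\<bar> < int (2 ^ nat \<bar>m\<bar>)"
    by (metis less_exp nat_less_iff abs_ge_zero zless_nat_eq_int_zless)
  also have "\<dots> \<le> int CARD('p) ^ nat \<bar>m\<bar>"
    using prime_ge_2_nat[OF prime_card[where 'a = 'p]] by (simp add: power_mono)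
  finally show "m = 0"
    using *[of "nat \<bar>m\<bar>"] dvd_imp_le_int[of m "int CARD('p) ^ nat \<bar>m\<bar>"]
    by (cases "m = 0") (auto simp: dvd_eq_mod_eq_0 power_abs)
qed simp

lemma pp_nonzero [simp]: "(pp :: 'p::prime_card padic) \<noteq> 0"
  using of_int_padic_eq_0_iff[of "int CARD('p)", where 'p = 'p] by simp

lemma two_padic_nonzero [simp]: "(2 :: 'p::prime_card padic) \<noteq> 0"
  using of_int_padic_eq_0_iff[of 2, where 'p = 'p] by simp

text \<open>
  The residues above level \<open>k\<close>, divided by \<open>p ^ k\<close>, are again a coherent sequence, and this
  sequence is the quotient \<open>Y\<close>.
\<close>

lemma padic_ints_residue:
  assumes "X \<in> (padic_ints :: 'p::prime_card padic set)"
  obtains a Y where "0 \<le> a" "a < int CARD('p) ^ k" "Y \<in> padic_ints" "X = of_int a + pp ^ k * Y"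
proof -
  obtain x :: "'p padic_int" where X: "X = of_padic_int x"
    using assms by (auto simp: padic_ints_def)
  let ?p = "int CARD('p)"
  have p: "?p > 0" by simp
  define a where "a = padic_res x k"
  have coh: "\<forall>n. padic_res x n = padic_res x (Suc n) mod ?p ^ n"
    using padic_res[of x] by blast
  have "a = a mod ?p ^ k"
    unfolding a_def by (rule coherent_mod_self[OF coh, symmetric])
  then have a: "0 \<le> a" "a < ?p ^ k"
    using pos_mod_sign[of "?p ^ k" a] pos_mod_bound[of "?p ^ k" a] p by simp_all
  define f where "f n = padic_res x (n + k) div ?p ^ k" for n
  have split: "padic_res x (n + k) = a + ?p ^ k * f n" for n
    using coherent_mod_le[OF coh, of k "n + k"] div_mult_mod_eq[of "padic_res x (n + k)" "?p ^ k"]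
    unfolding a_def f_def by (simp add: mult.commute)
  have "f n = f (Suc n) mod ?p ^ n" for n
  proof -
    have 1: "padic_res x (n + k) = padic_res x (Suc n + k) mod ?p ^ (n + k)"
      using coherent_mod_le[OF coh, of "n + k" "Suc n + k"] by simp
    have 2: "(u mod ?p ^ (n + k)) div ?p ^ k = u div ?p ^ k mod ?p ^ n" for u
      using p by (simp add: power_add mult.commute[of "?p ^ n"] zmod_zmult2_eq)
    show ?thesis
      unfolding f_def by (subst 1, subst 2) simp
  qed
  then have f: "f \<in> {f. \<forall>n. f n = f (Suc n) mod ?p ^ n}"
    by blast
  define y :: "'p padic_int" where "y = Abs_padic_int f"
  have res_y: "padic_res y = f"
    unfolding y_def by (rule Abs_padic_int_inverse[OF f])
  have "x = of_int a + of_nat CARD('p) ^ k * y"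
  proof (subst padic_res_inject[symmetric], rule ext)
    fix n
    have "padic_res (of_int a + of_nat CARD('p) ^ k * y) n
        = padic_res (of_int a + of_int (?p ^ k) * y) n"
      by simp
    also have "\<dots> = (a + ?p ^ k * f n) mod ?p ^ n"
      unfolding plus_padic_int.rep_eq times_padic_int.rep_eq padic_res_of_int res_y
      by (simp only: mod_simps)
    also have "\<dots> = padic_res x (n + k) mod ?p ^ n"
      by (simp add: split)
    also have "\<dots> = padic_res x n"
      using coherent_mod_le[OF coh, of n "n + k"] by simp
    finally show "padic_res x n = padic_res (of_int a + of_nat CARD('p) ^ k * y) n" ..
  qed
  then have "X = of_int a + pp ^ k * of_padic_int y"
    by (simp add: X of_padic_int_hom)
  with a show thesis
    by (intro that[of a "of_padic_int y"]) auto
qed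

text \<open>
  Multiplying by \<open>p ^ k\<close> and reading off the residue at level \<open>k\<close> reduces integrality in the field
  to a divisibility of integers; everything below that concerns congruences passes through here.
\<close>

lemma of_int_div_in_padic_ints_iff:
  "of_int a / pp ^ k \<in> (padic_ints :: 'p::prime_card padic set) \<longleftrightarrow> int CARD('p) ^ k dvd a"
proof
  assume "of_int a / pp ^ k \<in> (padic_ints :: 'p padic set)"
  then obtain y :: "'p padic_int" where "of_int a / pp ^ k = of_padic_int y"
    by (auto simp: padic_ints_def)
  then have "of_padic_int (of_int a) = of_padic_int (of_int (int CARD('p) ^ k) * y)"
    by (simp add: of_padic_int_hom field_simps)
  then have "padic_res (of_int a :: 'p padic_int) k = padic_res (of_int (int CARD('p) ^ k) * y) k"
    by (simp only: of_padic_int_inject)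
  then have "a mod int CARD('p) ^ k = 0"
    unfolding times_padic_int.rep_eq padic_res_of_int by simp
  then show "int CARD('p) ^ k dvd a" by auto
next
  assume "int CARD('p) ^ k dvd a"
  then obtain b where "a = int CARD('p) ^ k * b" ..
  then have "of_int a / pp ^ k = (of_int b :: 'p padic)" by simp
  then show "of_int a / pp ^ k \<in> (padic_ints :: 'p padic set)" by simp
qed

lemma residue_unique:
  assumes "(of_int a - of_int b) / pp ^ k \<in> (padic_ints :: 'p::prime_card padic set)"
    and "0 \<le> a" "a < int CARD('p) ^ k" "0 \<le> b" "b < int CARD('p) ^ k"
  shows "a = b"
proof -
  have "int CARD('p) ^ k dvd a - b"
    using assms(1) by (simp flip: of_int_diff of_int_div_in_padic_ints_iff)
  then have "a mod int CARD('p) ^ k = b mod int CARD('p) ^ k"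
    by (simp only: mod_eq_dvd_iff)
  then show ?thesis
    using assms(2-) by simp
qed

text \<open>
  Modulo \<open>p ^ j\<close> the identity exhibits an inverse of \<open>a\<close>. For \<open>j = 0\<close> the conclusion is empty, which
  is why the degenerate moduli need no separate treatment.
\<close>

lemma coprime_residue:
  assumes "1 = pp ^ j * A + of_int a * B"
    and "A \<in> (padic_ints :: 'p::prime_card padic set)" "B \<in> padic_ints"
  shows "coprime a (int CARD('p) ^ j)"
proof -
  obtain b B' where b: "B' \<in> padic_ints" "B = of_int b + pp ^ j * B'"
    using padic_ints_residue[OF assms(3), of j] by metis
  have "of_int (1 - a * b) / pp ^ j = A + of_int a * B'"
    using assms(1) b(2) by (simp add: field_simps)
  moreover have "A + of_int a * B' \<in> padic_ints"
    using assms b by auto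
  ultimately have "int CARD('p) ^ j dvd 1 - a * b"
    by (metis of_int_div_in_padic_ints_iff)
  then have "[a * b = 1] (mod int CARD('p) ^ j)"
    by (metis cong_iff_dvd_diff cong_sym)
  then show ?thesis
    unfolding coprime_iff_invertible_int by (rule exI)
qed

text \<open>
  A case of the integral closedness of \<open>Z_p\<close> in which the denominator is a power of \<open>p\<close>. It follows
  from the primality of \<open>p\<close>: if \<open>k > 0\<close> then \<open>p\<close> divides the square of a residue of \<open>Y\<close>, hence \<open>Y\<close>, and
  one factor \<open>p\<close> cancels.
\<close>

lemma padic_ints_quotient_root:
  assumes "(Y / pp ^ k) ^ 2 \<in> (padic_ints :: 'p::prime_card padic set)" "Y \<in> padic_ints"
  shows "Y / pp ^ k \<in> padic_ints"
  using assms
proof (induction k arbitrary: Y)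
  case (Suc k)
  obtain a Y1 where Y: "Y1 \<in> padic_ints" "Y = of_int a + pp ^ 1 * Y1"
    using padic_ints_residue[OF Suc.prems(2), of 1] by metis
  define Z where "Z = Y / pp ^ Suc k"
  have "Y = pp * (pp ^ k * Z)"
    by (simp add: Z_def)
  then have a: "of_int a = pp * (pp ^ k * Z - Y1)"
    by (simp add: Y(2) algebra_simps)
  have "of_int a ^ 2 = pp * (pp * (pp ^ (2 * k) * Z ^ 2) - (2 * of_int a * Y1 + pp * Y1 ^ 2))"
    unfolding a power2_eq_square power_add mult_2[of k] by (simp only: ring_distribs mult_2) (simp only: algebra_simps)
  then have "of_int (a ^ 2) / pp ^ 1
      = pp * (pp ^ (2 * k) * Z ^ 2) - (2 * of_int a * Y1 + pp * Y1 ^ 2)"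
    by simp
  also have "\<dots> = of_nat (CARD('p) ^ (2 * k + 1)) * Z ^ 2 - (of_int (2 * a) * Y1 + pp * Y1 ^ 2)"
    by simp
  also have "\<dots> \<in> padic_ints"
    using Suc.prems(1) by (intro padic_ints_diff padic_ints_add padic_ints_mult[OF padic_ints_of_nat]
        padic_ints_mult[OF padic_ints_of_int] padic_ints_power[OF Y(1)] Y(1)) (simp only: Z_def)
  finally have "int CARD('p) ^ 1 dvd a ^ 2"
    by (simp only: of_int_div_in_padic_ints_iff)
  then have "int CARD('p) dvd a"
    using prime_card_int[where 'a = 'p] by (simp add: prime_dvd_power_iff)
  then obtain b where "a = int CARD('p) * b" ..
  then have "Y = pp * (of_int b + Y1)"
    by (simp add: Y algebra_simps)
  then have *: "Y / pp ^ Suc k = (of_int b + Y1) / pp ^ k"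
    by simp
  have "((of_int b + Y1) / pp ^ k) ^ 2 \<in> padic_ints"
    using Suc.prems(1) by (simp only: *)
  moreover have "of_int b + Y1 \<in> padic_ints"
    using Y(1) by (intro padic_ints_add padic_ints_of_int)
  ultimately show ?case
    unfolding * by (rule Suc.IH)
qed simp

section \<open>The additive character\<close>

lemma e_real_int: "e_real (of_int n) = 1"
  by (auto simp: e_real_def exp_eq_1)

lemma e_real_add: "e_real (x + y) = e_real x * e_real y"
  by (simp add: e_real_def exp_add[symmetric] algebra_simps)

text \<open>
  Two approximations of \<open>x\<close> by fractions with denominators \<open>p ^ k\<close> and \<open>p ^ l\<close> differ by a rational
  number that is a p-adic integer, hence by an integer, so the description in \<^const>\<open>e_padic\<close> is
  unambiguous.
\<close>

lemma e_padic_eqI: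
  assumes "x - of_int a / pp ^ k \<in> (padic_ints :: 'p::prime_card padic set)"
  shows "e_padic x = e_real (of_int a / of_nat CARD('p) ^ k)"
proof -
  let ?p = "int CARD('p)"
  have unique: "e_real (of_int a / of_nat CARD('p) ^ k) = e_real (of_int b / of_nat CARD('p) ^ l)"
    if b: "x - of_int b / pp ^ l \<in> padic_ints" for b l
  proof -
    have "of_int (a * ?p ^ l - b * ?p ^ k) / pp ^ (k + l)
       = (x - of_int b / pp ^ l) - (x - of_int a / pp ^ k)"
      by (simp add: field_simps power_add)
    also have "\<dots> \<in> padic_ints"
      using assms b by blast
    finally have "?p ^ (k + l) dvd a * ?p ^ l - b * ?p ^ k"
      by (simp only: of_int_div_in_padic_ints_iff)
    then obtain c where "a * ?p ^ l - b * ?p ^ k = ?p ^ (k + l) * c" ..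
    then have "real_of_int (a * ?p ^ l - b * ?p ^ k) = real_of_int (?p ^ (k + l) * c)"
      by (rule arg_cong)
    then have "real_of_int a / of_nat CARD('p) ^ k = of_int b / of_nat CARD('p) ^ l + of_int c"
      by (simp add: field_simps power_add)
    then show ?thesis
      by (simp add: e_real_add e_real_int)
  qed
  show ?thesis
    unfolding e_padic_def of_nat_power
  proof (rule the_equality)
    show "\<exists>b l. x - of_int b / pp ^ l \<in> padic_ints \<and>
        e_real (of_int a / of_nat CARD('p) ^ k) = e_real (of_int b / of_nat CARD('p) ^ l)"
      using assms by blast
  qed (use unique in metis)
qed

text \<open>
  The property that characterises the value at \<open>x\<close> is literally the same for \<open>x + z\<close>, so this holds
  for every \<open>x\<close>.
\<close>

lemma e_padic_add_padic_int:
  assumes "z \<in> (padic_ints :: 'p::prime_card padic set)"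
  shows "e_padic (z + x) = e_padic x" "e_padic (x + z) = e_padic x"
proof -
  have "z + x - y \<in> padic_ints \<longleftrightarrow> x - y \<in> padic_ints" for y
  proof -
    have "(z + x - y) - z = x - y" "z + (x - y) = z + x - y" by simp_all
    then show ?thesis
      using padic_ints_diff[OF _ assms, of "z + x - y"] padic_ints_add[OF assms, of "x - y"]
      by (simp only:) blast
  qed
  then show "e_padic (z + x) = e_padic x"
    by (simp add: e_padic_def)
  then show "e_padic (x + z) = e_padic x"
    by (simp add: add.commute)
qed

lemma e_padic_0 [simp]: "e_padic (0 :: 'p::prime_card padic) = 1"
  using e_padic_eqI[of "0 :: 'p padic" 0 0] e_real_int[of 0] by simp

text \<open>
  The elements whose denominator is a power of \<open>p\<close>. For them the approximations in
  \<^const>\<open>e_padic\<close> are at hand, and all arguments of the character that occur are of this form.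
\<close>

definition padic_rational :: "'p::prime_card padic set" where
  "padic_rational = {of_padic_int m / pp ^ k | m k. True}"

lemma padic_rationalE:
  assumes "x \<in> (padic_rational :: 'p::prime_card padic set)"
  obtains a k where "x - of_int a / pp ^ k \<in> padic_ints"
proof -
  obtain m :: "'p padic_int" and k where x: "x = of_padic_int m / pp ^ k"
    using assms by (auto simp: padic_rational_def)
  obtain a Y where "Y \<in> padic_ints" "of_padic_int m = of_int a + pp ^ k * Y"
    using padic_ints_residue[OF of_padic_int_in[of m], of k] by metis
  then have "x - of_int a / pp ^ k \<in> padic_ints"
    by (simp add: x field_simps)
  then show thesis by (rule that)
qed

lemma e_padic_add:
  assumes "x \<in> (padic_rational :: 'p::prime_card padic set)" "y \<in> padic_rational"
  shows "e_padic (x + y) = e_padic x * e_padic y"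
proof -
  obtain a k where a: "x - of_int a / pp ^ k \<in> padic_ints"
    using assms(1) by (rule padic_rationalE)
  obtain b l where b: "y - of_int b / pp ^ l \<in> padic_ints"
    using assms(2) by (rule padic_rationalE)
  have "x + y - of_int (a * int CARD('p) ^ l + b * int CARD('p) ^ k) / pp ^ (k + l)
      = (x - of_int a / pp ^ k) + (y - of_int b / pp ^ l)"
    by (simp add: field_simps power_add)
  also have "\<dots> \<in> padic_ints"
    using a b by blast
  finally have "e_padic (x + y)
      = e_real (of_int (a * int CARD('p) ^ l + b * int CARD('p) ^ k) / of_nat CARD('p) ^ (k + l))"
    by (rule e_padic_eqI)
  also have "of_int (a * int CARD('p) ^ l + b * int CARD('p) ^ k) / of_nat CARD('p) ^ (k + l)
      = real_of_int a / of_nat CARD('p) ^ k + of_int b / of_nat CARD('p) ^ l"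
    by (simp add: field_simps power_add)
  also have "e_real \<dots> = e_padic x * e_padic y"
    by (simp add: e_real_add e_padic_eqI[OF a] e_padic_eqI[OF b])
  finally show ?thesis .
qed

section \<open>Explicit matrices of size six\<close>

lemma exhaust_6:
  fixes x :: 6
  shows "x = 1 \<or> x = 2 \<or> x = 3 \<or> x = 4 \<or> x = 5 \<or> x = 6"
proof (induct x)
  case (of_int z)
  then have "z = 0 \<or> z = 1 \<or> z = 2 \<or> z = 3 \<or> z = 4 \<or> z = 5" by fastforce
  then show ?case by auto
qed

lemma forall_6: "(\<forall>i::6. P i) \<longleftrightarrow> P 1 \<and> P 2 \<and> P 3 \<and> P 4 \<and> P 5 \<and> P 6"
  by (metis exhaust_6)

lemma UNIV_6: "UNIV = {1, 2, 3, 4, 5, 6::6}"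
  using exhaust_6 by auto

lemma sum_6: "sum f (UNIV::6 set) = f 1 + f 2 + f 3 + f 4 + f 5 + f 6"
  unfolding UNIV_6 by (simp add: ac_simps)

lemma vector_6 [simp]:
  "(vector [a, b, c, d, e, f] :: 'a::zero ^ 6) $ 1 = a"
  "(vector [a, b, c, d, e, f] :: 'a ^ 6) $ 2 = b"
  "(vector [a, b, c, d, e, f] :: 'a ^ 6) $ 3 = c"
  "(vector [a, b, c, d, e, f] :: 'a ^ 6) $ 4 = d"
  "(vector [a, b, c, d, e, f] :: 'a ^ 6) $ 5 = e"
  "(vector [a, b, c, d, e, f] :: 'a ^ 6) $ 6 = f"
  unfolding vector_def by simp_all

lemma vector_6_eq_iff:
  "(vector [a, b, c, d, e, f] :: 'a::zero ^ 6) = vector [a', b', c', d', e', f'] \<longleftrightarrow>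
   a = a' \<and> b = b' \<and> c = c' \<and> d = d' \<and> e = e' \<and> f = f'"
  by (auto simp: vec_eq_iff forall_6)

lemma matrix_mult_6:
  "(A ** B) $ i $ j = A $ i $ 1 * B $ 1 $ j + A $ i $ 2 * B $ 2 $ j + A $ i $ 3 * B $ 3 $ j
     + A $ i $ 4 * B $ 4 $ j + A $ i $ 5 * B $ 5 $ j + A $ i $ 6 * B $ 6 $ j"
  for A B :: "'a::semiring_1 ^ 6 ^ 6"
  by (simp add: matrix_matrix_mult_def sum_6)

lemma transpose_entry: "transpose A $ i $ j = A $ j $ i"
  by (simp add: transpose_def)

text \<open>
  Together with the next rule this computes products of matrices given by their entries, row by row.
\<close>

lemma rows_mult_6:
  "(vector [a1, a2, a3, a4, a5, a6] :: 'a::comm_ring_1 ^ 6 ^ 6) ** B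
   = vector [a1 v* B, a2 v* B, a3 v* B, a4 v* B, a5 v* B, a6 v* B]"
  unfolding vec_eq_iff forall_6 by (simp add: matrix_matrix_mult_def vector_matrix_mult_def mult.commute)

lemma row_mult_6:
  "(vector [x1, x2, x3, x4, x5, x6] :: 'a::comm_ring_1 ^ 6) v* (vector
     [vector [b11, b12, b13, b14, b15, b16],
      vector [b21, b22, b23, b24, b25, b26],
      vector [b31, b32, b33, b34, b35, b36],
      vector [b41, b42, b43, b44, b45, b46],
      vector [b51, b52, b53, b54, b55, b56],
      vector [b61, b62, b63, b64, b65, b66]] :: 'a ^ 6 ^ 6) = vector
     [x1 * b11 + x2 * b21 + x3 * b31 + x4 * b41 + x5 * b51 + x6 * b61,
      x1 * b12 + x2 * b22 + x3 * b32 + x4 * b42 + x5 * b52 + x6 * b62,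
      x1 * b13 + x2 * b23 + x3 * b33 + x4 * b43 + x5 * b53 + x6 * b63,
      x1 * b14 + x2 * b24 + x3 * b34 + x4 * b44 + x5 * b54 + x6 * b64,
      x1 * b15 + x2 * b25 + x3 * b35 + x4 * b45 + x5 * b55 + x6 * b65,
      x1 * b16 + x2 * b26 + x3 * b36 + x4 * b46 + x5 * b56 + x6 * b66]"
  unfolding vec_eq_iff forall_6 by (simp add: vector_matrix_mult_def sum_6 mult.commute)

lemmas vector_mult_6 = rows_mult_6 row_mult_6

lemma transpose_vector_6:
  "transpose (vector
    [vector [a11, a12, a13, a14, a15, a16],
     vector [a21, a22, a23, a24, a25, a26],
     vector [a31, a32, a33, a34, a35, a36],
     vector [a41, a42, a43, a44, a45, a46],
     vector [a51, a52, a53, a54, a55, a56],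
     vector [a61, a62, a63, a64, a65, a66]] :: 'a::comm_ring_1 ^ 6 ^ 6) =
   vector
    [vector [a11, a21, a31, a41, a51, a61],
     vector [a12, a22, a32, a42, a52, a62],
     vector [a13, a23, a33, a43, a53, a63],
     vector [a14, a24, a34, a44, a54, a64],
     vector [a15, a25, a35, a45, a55, a65],
     vector [a16, a26, a36, a46, a56, a66]]"
  unfolding vec_eq_iff transpose_entry forall_6 by simp

section \<open>The orthogonal group and its unipotent subgroup\<close>

lemma U33_mat_eq_iff:
  "U33_mat x y z t u v = U33_mat x' y' z' t' u' v' \<longleftrightarrow>
   x = x' \<and> y = y' \<and> z = z' \<and> t = t' \<and> u = u' \<and> v = v'"
  by (auto simp: U33_mat_def vector_6_eq_iff)

lemma U33_mat_mult:
  "U33_mat x y z t u v ** U33_mat x' y' z' t' u' v' =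
   U33_mat (x + x') (y + y' + x * u') (z + z' - x * u' * v' - y * v' - t * u')
     (t + t' + x * v') (u + u') (v + v')"
  by (simp add: U33_mat_def vector_mult_6 vector_6_eq_iff algebra_simps)

lemma U33_mat_0: "U33_mat 0 0 0 0 0 0 = mat 1"
  unfolding vec_eq_iff forall_6 by (simp add: U33_mat_def mat_def)

lemma SO33_form_square: "SO33_form ** SO33_form = (mat 1 :: 'a::comm_ring_1 ^ 6 ^ 6)"
  by (simp add: SO33_form_def vector_mult_6 flip: U33_mat_0) (simp add: U33_mat_def)

lemma SO33_form_transpose: "transpose SO33_form = (SO33_form :: 'a::comm_ring_1 ^ 6 ^ 6)"
  by (simp add: SO33_form_def transpose_vector_6)

lemma U33_preserves_form:
  "U33_mat x y z t u v ** SO33_form ** transpose (U33_mat x y z t u v) = SO33_form"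
  by (simp add: U33_mat_def SO33_form_def vector_mult_6 transpose_vector_6 vector_6_eq_iff algebra_simps)

lemma det_form_preserving:
  fixes A :: "'a::field ^ 6 ^ 6"
  assumes "A ** SO33_form ** transpose A = SO33_form"
  shows "det A * det A = 1"
proof -
  have *: "det (SO33_form :: 'a ^ 6 ^ 6) * det (SO33_form :: 'a ^ 6 ^ 6) = 1"
    by (simp flip: det_mul add: SO33_form_square)
  moreover from * have "det A * det (SO33_form :: 'a ^ 6 ^ 6) * det A = det (SO33_form :: 'a ^ 6 ^ 6)"
    using arg_cong[OF assms, of det] by (simp add: det_mul)
  ultimately show ?thesis
    by auto
qed

text \<open>
  Square roots are found by halving the parameters and correcting for the non-commutative part of
  the multiplication law. They serve to compute determinants: preserving the form only gives
  determinant \<open>1\<close> or \<open>-1\<close>, but a square has determinant \<open>1\<close>.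
\<close>

lemma U33_sqrt:
  assumes "(2 :: 'a::field) \<noteq> 0"
  shows "\<exists>B \<in> U33. U33_mat x y z t u v = (B :: 'a ^ 6 ^ 6) ** B"
proof -
  define h where "h = 1 / (2 :: 'a)"
  have h: "a * h + a * h = a" for a
    using assms by (simp add: h_def)
  define y' t' where "y' = (y - x * u * h * h) * h" and "t' = (t - x * v * h * h) * h"
  define z' where "z' = (z + x * h * (u * h) * (v * h) + y' * (v * h) + t' * (u * h)) * h"
  have y: "y = y' + y' + x * h * (u * h)"
    using h[of "y - x * u * h * h"] by (simp add: y'_def algebra_simps)
  have t: "t = t' + t' + x * h * (v * h)"
    using h[of "t - x * v * h * h"] by (simp add: t'_def algebra_simps)
  have z: "z = z' + z' - x * h * (u * h) * (v * h) - y' * (v * h) - t' * (u * h)"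
    using h[of "z + x * h * (u * h) * (v * h) + y' * (v * h) + t' * (u * h)"]
    unfolding z'_def[symmetric] by (simp add: algebra_simps)
  have "U33_mat x y z t u v = U33_mat (x * h) y' z' t' (u * h) (v * h) ** U33_mat (x * h) y' z' t' (u * h) (v * h)"
    unfolding U33_mat_mult U33_mat_eq_iff h using y t z by simp
  then show ?thesis
    unfolding U33_def by blast
qed

lemma U33_in_SO33:
  assumes "A \<in> U33"
  shows "(A :: 'p::prime_card padic ^ 6 ^ 6) \<in> SO33"
proof -
  have form: "B ** SO33_form ** transpose B = SO33_form" if "B \<in> U33" for B :: "'p padic ^ 6 ^ 6"
    using that by (auto simp: U33_def U33_preserves_form)
  obtain B :: "'p padic ^ 6 ^ 6" where "B \<in> U33" "A = B ** B"
    using assms U33_sqrt[OF two_padic_nonzero] unfolding U33_def by blast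
  then have "det A = 1"
    using det_form_preserving[OF form] by (simp add: det_mul)
  then show ?thesis
    using form[OF assms] by (simp add: SO33_def)
qed

definition SO33_inv :: "'a::comm_ring_1 ^ 6 ^ 6 \<Rightarrow> 'a ^ 6 ^ 6" where
  "SO33_inv A = SO33_form ** transpose A ** SO33_form"

lemma SO33_inv_right:
  assumes "A \<in> SO33"
  shows "A ** SO33_inv A = mat 1"
  using assms
  by (simp add: SO33_def SO33_inv_def matrix_mul_assoc SO33_form_square)

lemma SO33_inv_left:
  fixes A :: "'a::field ^ 6 ^ 6"
  assumes "A \<in> SO33"
  shows "SO33_inv A ** A = mat 1"
  using SO33_inv_right[OF assms] matrix_left_right_inverse by blast

lemma SO33_inv_cancel:
  fixes A :: "'a::field ^ 6 ^ 6"
  assumes "A \<in> SO33"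
  shows "SO33_inv A ** (A ** B) = B" "A ** (SO33_inv A ** B) = B"
    "B ** A ** SO33_inv A = B" "B ** SO33_inv A ** A = B"
  using SO33_inv_right[OF assms] SO33_inv_left[OF assms]
  by (simp_all add: matrix_mul_assoc flip: matrix_mul_assoc[of B])

lemma SO33_mult:
  assumes "A \<in> SO33" "B \<in> SO33"
  shows "A ** B \<in> SO33"
proof -
  have "A ** B ** SO33_form ** transpose (A ** B) = A ** (B ** SO33_form ** transpose B) ** transpose A"
    by (simp add: matrix_transpose_mul matrix_mul_assoc)
  then show ?thesis
    using assms by (simp add: SO33_def det_mul)
qed

lemma SO33_one: "mat 1 \<in> SO33"
  by (simp add: SO33_def transpose_mat)

lemma SO33_inv_in:
  fixes A :: "'a::field ^ 6 ^ 6"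
  assumes "A \<in> SO33"
  shows "SO33_inv A \<in> SO33"
proof -
  have "SO33_inv A ** SO33_form ** transpose (SO33_inv A)
      = SO33_inv A ** (SO33_form ** SO33_form) ** A ** SO33_form"
    by (simp add: SO33_inv_def matrix_transpose_mul SO33_form_transpose matrix_mul_assoc)
  also have "\<dots> = SO33_form"
    by (simp add: SO33_form_square SO33_inv_left[OF assms])
  finally have "SO33_inv A ** SO33_form ** transpose (SO33_inv A) = SO33_form" .
  moreover have "det (A ** SO33_inv A) = 1"
    by (simp add: SO33_inv_right[OF assms])
  ultimately show ?thesis
    using assms by (simp add: SO33_def det_mul)
qed

lemma matrix_inv_SO33:
  fixes A :: "'a::field ^ 6 ^ 6"
  assumes "A \<in> SO33"
  shows "matrix_inv A = SO33_inv A"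
proof -
  have "\<exists>B. A ** B = mat 1 \<and> B ** A = mat 1"
    using SO33_inv_right[OF assms] SO33_inv_left[OF assms] by blast
  then have "A ** matrix_inv A = mat 1 \<and> matrix_inv A ** A = mat 1"
    unfolding matrix_inv_def by (rule someI_ex)
  then show ?thesis
    by (metis SO33_inv_cancel(1)[OF assms] matrix_mul_rid)
qed

lemma U33_one: "mat 1 \<in> U33"
  unfolding U33_def U33_mat_0[symmetric] by blast

lemma U33_mult: "A \<in> U33 \<Longrightarrow> B \<in> U33 \<Longrightarrow> A ** B \<in> U33"
  by (auto simp: U33_def U33_mat_mult U33_mat_eq_iff)

lemma U33_inv:
  fixes A :: "'p::prime_card padic ^ 6 ^ 6"
  assumes "A \<in> U33"
  shows "SO33_inv A \<in> U33"
proof -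
  obtain x y z t u v where A: "A = U33_mat x y z t u v"
    using assms by (auto simp: U33_def)
  let ?B = "U33_mat (- x) (x * u - y) (x * u * v - y * v - t * u - z) (x * v - t) (- u) (- v)"
  have "A ** ?B = mat 1"
    unfolding A U33_mat_mult U33_mat_0[symmetric] U33_mat_eq_iff by (simp add: algebra_simps)
  then have "SO33_inv A = ?B"
    by (metis SO33_inv_cancel(1) U33_in_SO33 assms matrix_mul_rid)
  then show ?thesis
    unfolding U33_def by blast
qed

lemma U33_Int_opposite:
  assumes "A \<in> U33" "transpose A \<in> U33"
  shows "A = mat 1"
proof -
  obtain x y z t u v where A: "A = U33_mat x y z t u v"
    using assms by (auto simp: U33_def)
  obtain x' y' z' t' u' v' where "transpose A = U33_mat x' y' z' t' u' v'"
    using assms by (auto simp: U33_def)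
  then have "x = 0 \<and> y = 0 \<and> z = 0 \<and> t = 0 \<and> u = 0 \<and> v = 0"
    by (simp add: A U33_mat_def transpose_vector_6 vector_6_eq_iff)
  then show ?thesis
    by (simp add: A U33_mat_0)
qed

section \<open>The subgroup on the right of the Bruhat decomposition\<close>

text \<open>
  Clearing the inverse of \<open>n\<close> makes membership an identity between matrix products, which can be
  checked entry by entry.
\<close>

lemma U33_bar_iff:
  fixes n :: "'a::field ^ 6 ^ 6"
  assumes "n \<in> SO33"
  shows "w \<in> U33_bar n \<longleftrightarrow> w \<in> U33 \<and> (\<exists>a\<in>U33. n ** w = transpose a ** n)"
proof -
  have "w = matrix_inv n ** a ** n \<longleftrightarrow> n ** w = a ** n" for a
    unfolding matrix_inv_SO33[OF assms]
    using SO33_inv_cancel(1,2)[OF assms] by (metis matrix_mul_assoc)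
  then show ?thesis
    unfolding U33_bar_def U33_minus_def by auto
qed

lemma U33_mult_n_bar_in_SO33:
  assumes "u \<in> U33" "n \<in> SO33" "w \<in> U33_bar n"
  shows "u ** n ** (w :: 'p::prime_card padic ^ 6 ^ 6) \<in> SO33"
  using assms U33_in_SO33[of w] by (intro SO33_mult U33_in_SO33[OF assms(1)]) (auto simp: U33_bar_iff)

lemma U33_bar_one:
  assumes "(n :: 'p::prime_card padic ^ 6 ^ 6) \<in> SO33"
  shows "mat 1 \<in> U33_bar n"
  unfolding U33_bar_iff[OF assms] using U33_one by (auto intro!: bexI[of _ "mat 1"] simp: transpose_mat)

lemma U33_bar_mult:
  assumes "(n :: 'p::prime_card padic ^ 6 ^ 6) \<in> SO33" "v \<in> U33_bar n" "w \<in> U33_bar n"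
  shows "v ** w \<in> U33_bar n"
proof -
  obtain a b where "a \<in> U33" "n ** v = transpose a ** n" "b \<in> U33" "n ** w = transpose b ** n"
    using assms by (auto simp: U33_bar_iff)
  then have "n ** (v ** w) = transpose (b ** a) ** n" "b ** a \<in> U33"
    by (simp_all add: U33_mult matrix_transpose_mul matrix_mul_assoc)
      (simp flip: matrix_mul_assoc)
  then show ?thesis
    using assms by (auto simp: U33_bar_iff U33_mult)
qed

lemma U33_bar_inv:
  assumes "(n :: 'p::prime_card padic ^ 6 ^ 6) \<in> SO33" "w \<in> U33_bar n"
  shows "SO33_inv w \<in> U33_bar n"
proof -
  obtain a where a: "a \<in> U33" "n ** w = transpose a ** n" and w: "w \<in> U33"
    using assms by (auto simp: U33_bar_iff)
  have "transpose (SO33_inv a) ** transpose a = transpose (a ** SO33_inv a)"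
    by (simp add: matrix_transpose_mul)
  also have "\<dots> = mat 1"
    by (simp add: SO33_inv_right U33_in_SO33 a transpose_mat)
  finally have inv: "transpose (SO33_inv a) ** transpose a = mat 1" .
  have "n ** SO33_inv w = transpose (SO33_inv a) ** transpose a ** n ** SO33_inv w"
    by (simp add: inv)
  also have "\<dots> = transpose (SO33_inv a) ** (n ** w) ** SO33_inv w"
    by (simp add: a matrix_mul_assoc)
  also have "\<dots> = transpose (SO33_inv a) ** n"
    using SO33_inv_cancel(3)[OF U33_in_SO33[OF w]] by (metis matrix_mul_assoc)
  finally show ?thesis
    using assms a w by (auto simp: U33_bar_iff U33_inv)
qed

text \<open>
  The quotient of the left factors lies in \<open>U33\<close> and, being conjugate by \<open>n\<close> to a quotient of right
  factors, also in the opposite group; the two groups meet only in the identity.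
\<close>

lemma bruhat_unique:
  assumes n: "(n :: 'p::prime_card padic ^ 6 ^ 6) \<in> SO33"
    and u: "u \<in> U33" "u' \<in> U33" and w: "w \<in> U33_bar n" "w' \<in> U33_bar n"
    and eq: "u ** n ** w = u' ** n ** w'"
  shows "u = u'" "w = w'"
proof -
  define c where "c = SO33_inv u' ** u"
  define d where "d = w' ** SO33_inv w"
  have c: "c \<in> U33"
    by (simp add: c_def U33_mult U33_inv u)
  have "d \<in> U33_bar n"
    by (simp add: d_def U33_bar_mult U33_bar_inv n w)
  then obtain a where a: "a \<in> U33" "n ** d = transpose a ** n"
    using n by (auto simp: U33_bar_iff)
  have wS: "w \<in> SO33"
    using w n U33_in_SO33 by (auto simp: U33_bar_iff)
  have "c ** n = SO33_inv u' ** (u ** n ** w) ** SO33_inv w"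
    using SO33_inv_cancel(3)[OF wS] by (simp add: c_def matrix_mul_assoc)
  also have "\<dots> = n ** d"
    using SO33_inv_left[OF U33_in_SO33[OF u(2)]] by (simp add: eq d_def matrix_mul_assoc)
  finally have "c ** n = transpose a ** n"
    using a by simp
  then have "c = transpose a"
    using SO33_inv_cancel(3)[OF n] by metis
  then have c1: "c = mat 1"
    using U33_Int_opposite[OF c] a by (simp add: transpose_transpose)
  then have "u' ** c = u'"
    by simp
  then show "u = u'"
    by (simp add: c_def SO33_inv_cancel(2)[OF U33_in_SO33[OF u(2)]])
  then have "u ** (n ** w) = u ** (n ** w')"
    using eq by (simp add: matrix_mul_assoc)
  then show "w = w'"
    using SO33_inv_cancel(1)[OF U33_in_SO33[OF u(1)]] SO33_inv_cancel(1)[OF n] by metis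
qed

section \<open>Kloosterman sums as sums over representatives\<close>

definition integral_mat :: "'p::prime_card padic ^ 6 ^ 6 \<Rightarrow> bool" where
  "integral_mat A \<longleftrightarrow> (\<forall>i j. A $ i $ j \<in> padic_ints)"

lemma integral_points_iff:
  "A \<in> integral_points H \<longleftrightarrow> A \<in> H \<and> A \<in> SO33 \<and> integral_mat A"
  by (simp add: integral_points_def integral_mat_def)

lemma integral_mat_mult: "integral_mat A \<Longrightarrow> integral_mat B \<Longrightarrow> integral_mat (A ** B)"
  by (auto simp: integral_mat_def matrix_matrix_mult_def)

lemma integral_mat_one: "integral_mat (mat 1)"
  by (simp add: integral_mat_def mat_def)

lemma integral_mat_form: "integral_mat SO33_form"
  by (simp add: integral_mat_def forall_6 SO33_form_def)

lemma integral_mat_inv: "integral_mat A \<Longrightarrow> integral_mat (SO33_inv A)"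
  unfolding SO33_inv_def
  by (intro integral_mat_mult integral_mat_form) (simp add: integral_mat_def transpose_entry)

lemma integral_U33_mult:
  "k \<in> integral_points U33 \<Longrightarrow> l \<in> integral_points U33 \<Longrightarrow> k ** l \<in> integral_points U33"
  by (simp add: integral_points_iff U33_mult SO33_mult integral_mat_mult)

lemma integral_U33_inv:
  "k \<in> integral_points U33 \<Longrightarrow> SO33_inv k \<in> integral_points U33"
  by (simp add: integral_points_iff U33_inv SO33_inv_in integral_mat_inv)

lemma integral_bar_mult:
  "n \<in> SO33 \<Longrightarrow> k \<in> integral_points (U33_bar n) \<Longrightarrow> l \<in> integral_points (U33_bar n) \<Longrightarrow>
    k ** l \<in> integral_points (U33_bar n)"
  by (simp add: integral_points_iff U33_bar_mult SO33_mult integral_mat_mult)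

lemma integral_bar_inv:
  "n \<in> SO33 \<Longrightarrow> k \<in> integral_points (U33_bar n) \<Longrightarrow> SO33_inv k \<in> integral_points (U33_bar n)"
  by (simp add: integral_points_iff U33_bar_inv SO33_inv_in integral_mat_inv)

lemma U33_char_mult:
  assumes "a \<in> U33" "k \<in> integral_points U33"
  shows "U33_char m1 m2 m3 (k ** a) = U33_char m1 m2 m3 a"
    and "U33_char m1 m2 m3 (a ** k) = U33_char m1 m2 m3 a"
proof -
  obtain x y z t u v where a: "a = U33_mat x y z t u v"
    using assms by (auto simp: U33_def)
  obtain x' y' z' t' u' v' where k: "k = U33_mat x' y' z' t' u' v'"
    using assms by (auto simp: U33_def integral_points_iff)
  have "k $ 1 $ 2 \<in> padic_ints" "k $ 2 $ 3 \<in> padic_ints" "k $ 2 $ 6 \<in> padic_ints"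
    using assms by (auto simp: integral_points_iff integral_mat_def)
  then have int: "of_padic_int m1 * x' + of_padic_int m2 * u' + of_padic_int m3 * v' \<in> padic_ints"
    by (intro padic_ints_add padic_ints_mult of_padic_int_in) (simp_all add: k U33_mat_def)
  have char: "U33_char m1 m2 m3 (U33_mat x y z t u v)
      = e_padic (of_padic_int m1 * x + of_padic_int m2 * u + of_padic_int m3 * v)" for x y z t u v
    by (simp add: U33_char_def U33_mat_def)
  show "U33_char m1 m2 m3 (k ** a) = U33_char m1 m2 m3 a"
    unfolding a k U33_mat_mult char
    using e_padic_add_padic_int(1)[OF int, of "of_padic_int m1 * x + of_padic_int m2 * u + of_padic_int m3 * v"]
    by (simp add: algebra_simps)
  show "U33_char m1 m2 m3 (a ** k) = U33_char m1 m2 m3 a"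
    unfolding a k U33_mat_mult char
    using e_padic_add_padic_int(2)[OF int, of "of_padic_int m1 * x + of_padic_int m2 * u + of_padic_int m3 * v"]
    by (simp add: algebra_simps)
qed

lemma set_mult_assoc: "A \<cdot> B \<cdot> C = A \<cdot> (B \<cdot> C)"
proof -
  have "A \<cdot> B \<cdot> C = {a ** b ** c | a b c. a \<in> A \<and> b \<in> B \<and> c \<in> C}"
    unfolding set_mult_def by blast
  moreover have "A \<cdot> (B \<cdot> C) = {a ** (b ** c) | a b c. a \<in> A \<and> b \<in> B \<and> c \<in> C}"
    unfolding set_mult_def by blast
  ultimately show ?thesis
    by (simp only: matrix_mul_assoc)
qed

lemma set_mult_singletons: "{a} \<cdot> {b} = {a ** b}"
  by (auto simp: set_mult_def)

lemma set_mult_iff: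
  "x \<in> A \<cdot> {g} \<cdot> B \<longleftrightarrow> (\<exists>a\<in>A. \<exists>b\<in>B. x = a ** g ** b)"
  by (auto simp: set_mult_def)

text \<open>
  The pairs \<open>(a i, b i)\<close> represent \<open>X(n)\<close>: each \<open>a i n b i\<close> is integral, the \<open>b i\<close> are inequivalent
  modulo integral right factors, and every right factor \<open>w\<close> of an integral matrix \<open>u n w\<close> is
  equivalent to some \<open>b i\<close>. The left factors \<open>u\<close> of the covered matrices are not compared with the
  \<open>a i\<close>, since \<open>w\<close> determines \<open>u\<close> up to integral left factors.
\<close>

definition bruhat_reps ::
  "'p::prime_card padic ^ 6 ^ 6 \<Rightarrow> 'i set \<Rightarrow> ('i \<Rightarrow> 'p padic ^ 6 ^ 6) \<Rightarrow> ('i \<Rightarrow> 'p padic ^ 6 ^ 6) \<Rightarrow> bool"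
where
  "bruhat_reps n I a b \<longleftrightarrow> n \<in> SO33 \<and>
     (\<forall>i\<in>I. a i \<in> U33 \<and> b i \<in> U33_bar n \<and> integral_mat (a i ** n ** b i)) \<and>
     (\<forall>i\<in>I. \<forall>j\<in>I. \<forall>k\<in>integral_points (U33_bar n). b j = b i ** k \<longrightarrow> i = j) \<and>
     (\<forall>u\<in>U33. \<forall>w\<in>U33_bar n. integral_mat (u ** n ** w) \<longrightarrow>
        (\<exists>i\<in>I. \<exists>k\<in>integral_points (U33_bar n). w = b i ** k))"

lemma integral_U33_coset:
  assumes "k \<in> integral_points U33"
  shows "integral_points U33 \<cdot> {k ** a} = integral_points U33 \<cdot> {a :: 'p::prime_card padic ^ 6 ^ 6}"
proof -
  have "integral_points U33 \<cdot> {h ** a} \<subseteq> integral_points U33 \<cdot> {a}"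
    if "h \<in> integral_points U33" for h and a :: "'p padic ^ 6 ^ 6"
  proof
    fix x assume "x \<in> integral_points U33 \<cdot> {h ** a}"
    then obtain l where "l \<in> integral_points U33" "x = (l ** h) ** a"
      by (auto simp: set_mult_def matrix_mul_assoc)
    then show "x \<in> integral_points U33 \<cdot> {a}"
      using integral_U33_mult[OF _ that] unfolding set_mult_def by blast
  qed
  note subset = this
  have "SO33_inv k ** (k ** a) = a"
    using assms by (simp add: SO33_inv_cancel(1) integral_points_iff)
  then show ?thesis
    using subset[OF assms, of a] subset[OF integral_U33_inv[OF assms], of "k ** a"] by simp
qed

lemma integral_bar_coset:
  assumes "n \<in> SO33" "k \<in> integral_points (U33_bar n)"
  shows "{b ** k} \<cdot> integral_points (U33_bar n)
    = {b :: 'p::prime_card padic ^ 6 ^ 6} \<cdot> integral_points (U33_bar n)"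
proof -
  have "{b ** h} \<cdot> integral_points (U33_bar n) \<subseteq> {b} \<cdot> integral_points (U33_bar n)"
    if "h \<in> integral_points (U33_bar n)" for h and b :: "'p padic ^ 6 ^ 6"
  proof
    fix x assume "x \<in> {b ** h} \<cdot> integral_points (U33_bar n)"
    then obtain l where "l \<in> integral_points (U33_bar n)" "x = b ** (h ** l)"
      by (auto simp: set_mult_def matrix_mul_assoc)
    then show "x \<in> {b} \<cdot> integral_points (U33_bar n)"
      using integral_bar_mult[OF assms(1) that] unfolding set_mult_def by blast
  qed
  note subset = this
  have "b ** k ** SO33_inv k = b"
    using assms by (simp add: SO33_inv_cancel(3) integral_points_iff)
  then show ?thesis
    using subset[OF assms(2), of b] subset[OF integral_bar_inv[OF assms], of "b ** k"] by simp
qed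

lemma integral_U33_one: "mat 1 \<in> integral_points U33"
  by (simp add: integral_points_iff U33_one SO33_one integral_mat_one)

lemma integral_bar_one:
  "n \<in> SO33 \<Longrightarrow> mat 1 \<in> integral_points (U33_bar (n :: 'p::prime_card padic ^ 6 ^ 6))"
  by (simp add: integral_points_iff U33_bar_one SO33_one integral_mat_one)

text \<open>
  Any other pair of cosets with the same product contains representatives \<open>a'\<close> and \<open>b'\<close> with
  \<open>a' n b' = k a n b l\<close>, and uniqueness in the Bruhat decomposition gives \<open>a' = k a\<close> and \<open>b' = b l\<close>.
\<close>

lemma bruhat_pair_eq:
  fixes n :: "'p::prime_card padic ^ 6 ^ 6"
  assumes n: "n \<in> SO33" and a: "a \<in> U33" and b: "b \<in> U33_bar n"
  shows "bruhat_pair n (integral_points U33 \<cdot> {a ** n ** b} \<cdot> integral_points (U33_bar n))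
    = (integral_points U33 \<cdot> {a}, {b} \<cdot> integral_points (U33_bar n))"
proof -
  let ?K = "integral_points (U33 :: ('p padic ^ 6 ^ 6) set)" and ?L = "integral_points (U33_bar n)"
  have split: "?K \<cdot> {a' ** n ** b'} \<cdot> ?L = ?K \<cdot> {a'} \<cdot> {n} \<cdot> ({b'} \<cdot> ?L)" for a' b'
    by (simp add: set_mult_assoc flip: set_mult_singletons)
  have unique: "?K \<cdot> {a'} = ?K \<cdot> {a} \<and> {b'} \<cdot> ?L = {b} \<cdot> ?L"
    if "a' \<in> U33" "b' \<in> U33_bar n" "?K \<cdot> {a ** n ** b} \<cdot> ?L = ?K \<cdot> {a'} \<cdot> {n} \<cdot> ({b'} \<cdot> ?L)" for a' b'
  proof -
    have "a' ** n ** b' = mat 1 ** (a' ** n ** b') ** mat 1"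
      by simp
    then have "a' ** n ** b' \<in> ?K \<cdot> {a' ** n ** b'} \<cdot> ?L"
      unfolding set_mult_iff using integral_U33_one integral_bar_one[OF n] by blast
    then have "a' ** n ** b' \<in> ?K \<cdot> {a ** n ** b} \<cdot> ?L"
      using that(3) by (simp only: split)
    then obtain k l where kl: "k \<in> ?K" "l \<in> ?L" "a' ** n ** b' = k ** (a ** n ** b) ** l"
      unfolding set_mult_iff by blast
    have "a' ** n ** b' = (k ** a) ** n ** (b ** l)"
      by (simp add: kl matrix_mul_assoc)
    moreover have "k ** a \<in> U33" "b ** l \<in> U33_bar n"
      using kl a b n by (simp_all add: integral_points_iff U33_mult U33_bar_mult)
    ultimately have "a' = k ** a" "b' = b ** l"
      using bruhat_unique[OF n that(1) _ that(2)] by blast+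
    then show ?thesis
      using kl integral_U33_coset integral_bar_coset[OF n] by simp
  qed
  show ?thesis
    unfolding bruhat_pair_def
  proof (rule the_equality)
    show "case (?K \<cdot> {a}, {b} \<cdot> ?L) of (C, D) \<Rightarrow> C \<in> (\<lambda>a. ?K \<cdot> {a}) ` U33 \<and>
        D \<in> (\<lambda>b. {b} \<cdot> ?L) ` U33_bar n \<and> ?K \<cdot> {a ** n ** b} \<cdot> ?L = C \<cdot> {n} \<cdot> D"
      using a b split by auto
  next
    fix CD assume "case CD of (C, D) \<Rightarrow> C \<in> (\<lambda>a. ?K \<cdot> {a}) ` U33 \<and>
        D \<in> (\<lambda>b. {b} \<cdot> ?L) ` U33_bar n \<and> ?K \<cdot> {a ** n ** b} \<cdot> ?L = C \<cdot> {n} \<cdot> D"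
    then show "CD = (?K \<cdot> {a}, {b} \<cdot> ?L)"
      using unique by (auto split: prod.splits)
  qed
qed

lemma U33_char_coset:
  fixes n :: "'p::prime_card padic ^ 6 ^ 6"
  shows "a \<in> U33 \<Longrightarrow> the_elem (U33_char m1 m2 m3 ` (integral_points U33 \<cdot> {a})) = U33_char m1 m2 m3 a"
    and "n \<in> SO33 \<Longrightarrow> b \<in> U33_bar n \<Longrightarrow>
      the_elem (U33_char m1 m2 m3 ` ({b} \<cdot> integral_points (U33_bar n))) = U33_char m1 m2 m3 b"
proof -
  assume a: "a \<in> U33"
  have "mat 1 ** a \<in> integral_points U33 \<cdot> {a}"
    using integral_U33_one unfolding set_mult_def by blast
  then show "the_elem (U33_char m1 m2 m3 ` (integral_points U33 \<cdot> {a})) = U33_char m1 m2 m3 a"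
    by (intro the_elem_image_unique) (auto simp: set_mult_def U33_char_mult(1)[OF a])
next
  assume n: "n \<in> SO33" and b: "b \<in> U33_bar n"
  have bU: "b \<in> U33" and L: "k \<in> integral_points (U33_bar n) \<Longrightarrow> k \<in> integral_points U33" for k
    using b by (auto simp: U33_bar_def integral_points_iff)
  have "b ** mat 1 \<in> {b} \<cdot> integral_points (U33_bar n)"
    using integral_bar_one[OF n] unfolding set_mult_def by blast
  then show "the_elem (U33_char m1 m2 m3 ` ({b} \<cdot> integral_points (U33_bar n))) = U33_char m1 m2 m3 b"
    by (intro the_elem_image_unique) (auto simp: set_mult_def U33_char_mult(2)[OF bU] L)
qed

text \<open>
  The double cosets of the \<open>a i n b i\<close> enumerate \<^term>\<open>kl_X n\<close> without repetition, and their Bruhat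
  components are the cosets of \<open>a i\<close> and \<open>b i\<close>, on which the characters are constant.
\<close>

lemma kl_sum_eq_sum_reps:
  fixes n :: "'p::prime_card padic ^ 6 ^ 6"
  assumes reps: "bruhat_reps n I a b"
  shows "kl_sum (U33_char m1 m2 m3) (U33_char n1 n2 n3) n
    = (\<Sum>i\<in>I. U33_char m1 m2 m3 (a i) * U33_char n1 n2 n3 (b i))"
proof -
  let ?K = "integral_points (U33 :: ('p padic ^ 6 ^ 6) set)" and ?L = "integral_points (U33_bar n)"
  have n: "n \<in> SO33" and ab: "i \<in> I \<Longrightarrow> a i \<in> U33" "i \<in> I \<Longrightarrow> b i \<in> U33_bar n"
      "i \<in> I \<Longrightarrow> integral_mat (a i ** n ** b i)"
    and inj: "\<lbrakk>i \<in> I; j \<in> I; k \<in> ?L; b j = b i ** k\<rbrakk> \<Longrightarrow> i = j"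
    and surj: "\<lbrakk>u \<in> U33; w \<in> U33_bar n; integral_mat (u ** n ** w)\<rbrakk> \<Longrightarrow> \<exists>i\<in>I. \<exists>k\<in>?L. w = b i ** k" for i j k u w
    using reps unfolding bruhat_reps_def by blast+
  define f where "f i = ?K \<cdot> {a i ** n ** b i} \<cdot> ?L" for i
  have pair: "bruhat_pair n (f i) = (?K \<cdot> {a i}, {b i} \<cdot> ?L)" if "i \<in> I" for i
    unfolding f_def by (rule bruhat_pair_eq) (use n ab that in auto)
  have "inj_on f I"
  proof (rule inj_onI)
    fix i j assume ij: "i \<in> I" "j \<in> I" "f i = f j"
    then have "{b i} \<cdot> ?L = {b j} \<cdot> ?L"
      using pair by (metis prod.inject)
    moreover have "b j \<in> {b j} \<cdot> ?L"
      using integral_bar_one[OF n] by (force simp: set_mult_def)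
    ultimately obtain k where "k \<in> ?L" "b j = b i ** k"
      by (auto simp: set_mult_def)
    then show "i = j"
      using inj ij by blast
  qed
  moreover have "f ` I = kl_X n"
  proof (intro equalityI subsetI)
    fix x assume "x \<in> f ` I"
    then obtain i where i: "i \<in> I" "x = f i" by blast
    have "a i ** n ** b i \<in> U33 \<cdot> {n} \<cdot> U33_bar n \<inter> integral_points SO33"
      using ab[OF i(1)] U33_mult_n_bar_in_SO33[OF _ n] by (auto simp: set_mult_iff integral_points_iff)
    then show "x \<in> kl_X n"
      unfolding kl_X_def i f_def by blast
  next
    fix x assume "x \<in> kl_X n"
    then obtain u w where uw: "u \<in> U33" "w \<in> U33_bar n" "integral_mat (u ** n ** w)"
        "x = ?K \<cdot> {u ** n ** w} \<cdot> ?L"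
      unfolding kl_X_def by (auto simp: set_mult_iff integral_points_iff)
    obtain i k where ik: "i \<in> I" "k \<in> ?L" "w = b i ** k"
      using surj[OF uw(1-3)] by blast
    let ?g = "a i ** n ** b i"
    \<comment> \<open>The left factor relating \<open>u n w\<close> to the representative; it is a quotient of integral matrices.\<close>
    define h where "h = u ** SO33_inv (a i)"
    have hU: "h \<in> U33"
      by (simp add: h_def U33_mult U33_inv ab ik uw)
    have ha: "h ** a i = u"
      by (simp add: h_def SO33_inv_cancel(4) U33_in_SO33 ab ik)
    have g: "?g \<in> SO33"
      using U33_mult_n_bar_in_SO33[OF _ n] ab ik by blast
    have k: "k \<in> SO33"
      using ik by (simp add: integral_points_iff)
    have hgk: "u ** n ** w = h ** ?g ** k"
      by (simp add: matrix_mul_assoc ha ik)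
    then have "h = u ** n ** w ** SO33_inv k ** SO33_inv ?g"
      by (simp add: SO33_inv_cancel(3)[OF k] SO33_inv_cancel(3)[OF g])
    moreover have "integral_mat k"
      using ik by (simp add: integral_points_iff)
    then have "integral_mat (u ** n ** w ** SO33_inv k ** SO33_inv ?g)"
      by (rule integral_mat_mult[OF integral_mat_mult[OF uw(3) integral_mat_inv]
            integral_mat_inv[OF ab(3)[OF ik(1)]]])
    ultimately have "integral_mat h"
      by simp
    then have "h \<in> ?K"
      using hU U33_in_SO33 by (auto simp: integral_points_iff)
    have "?K \<cdot> {u ** n ** w} \<cdot> ?L = ?K \<cdot> {h ** (?g ** k)} \<cdot> ?L"
      by (simp only: hgk matrix_mul_assoc)
    also have "\<dots> = ?K \<cdot> ({?g ** k} \<cdot> ?L)"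
      by (simp only: integral_U33_coset[OF \<open>h \<in> ?K\<close>] set_mult_assoc)
    also have "\<dots> = f i"
      by (simp only: integral_bar_coset[OF n ik(2)] set_mult_assoc f_def)
    finally show "x \<in> f ` I"
      using uw ik by blast
  qed
  ultimately have "bij_betw f I (kl_X n)"
    by (simp add: bij_betw_def)
  then show ?thesis
    unfolding kl_sum_def
    by (subst sum.reindex_bij_betw[symmetric], assumption)
      (auto intro!: sum.cong simp: bruhat_u_def bruhat_u'_def pair U33_char_coset n ab)
qed

section \<open>Elements of the normalizer of the torus\<close>

lemma p_pow_add: "p_pow (r + s) = p_pow r * (p_pow s :: 'p::prime_card padic)"
  and p_pow_minus: "p_pow (- r) = inverse (p_pow r :: 'p padic)"
  and p_pow_diff: "p_pow (r - s) = p_pow r / (p_pow s :: 'p padic)"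
  and p_pow_nonzero [simp]: "p_pow r \<noteq> (0 :: 'p padic)"
  and p_pow_0 [simp]: "p_pow 0 = (1 :: 'p padic)"
  and p_pow_of_nat: "p_pow (int k) = (pp ^ k :: 'p padic)"
  by (simp_all add: p_pow_def power_int_add power_int_minus power_int_diff)

lemmas p_pow_simps = p_pow_add p_pow_minus p_pow_diff

lemma n_a_entries:
  "n_a r = vector
    [vector [1, 0, 0, 0, 0, 0],
     vector [0, 0, p_pow (- r), 0, 0, 0],
     vector [0, - p_pow r, 0, 0, 0, 0],
     vector [0, 0, 0, 1, 0, 0],
     vector [0, 0, 0, 0, 0, p_pow r],
     vector [0, 0, 0, 0, - p_pow (- r), 0]]"
  unfolding vec_eq_iff forall_6 by (simp add: n_a_def E_mat_def)

lemma n_b_entries: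
  "n_b r = vector
    [vector [0, p_pow (- r), 0, 0, 0, 0],
     vector [- p_pow r, 0, 0, 0, 0, 0],
     vector [0, 0, 1, 0, 0, 0],
     vector [0, 0, 0, 0, p_pow r, 0],
     vector [0, 0, 0, - p_pow (- r), 0, 0],
     vector [0, 0, 0, 0, 0, 1]]"
  unfolding vec_eq_iff forall_6 by (simp add: n_b_def E_mat_def)

lemma n_c_entries:
  "n_c r = vector
    [vector [1, 0, 0, 0, 0, 0],
     vector [0, 0, 0, 0, 0, - p_pow (- r)],
     vector [0, 0, 0, 0, p_pow (- r), 0],
     vector [0, 0, 0, 1, 0, 0],
     vector [0, 0, - p_pow r, 0, 0, 0],
     vector [0, p_pow r, 0, 0, 0, 0]]"
  unfolding vec_eq_iff forall_6 by (simp add: n_c_def E_mat_def)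

lemma n_ab_entries:
  "n_ab r s = vector
    [vector [0, p_pow (- r), 0, 0, 0, 0],
     vector [0, 0, p_pow (r - s), 0, 0, 0],
     vector [p_pow s, 0, 0, 0, 0, 0],
     vector [0, 0, 0, 0, p_pow r, 0],
     vector [0, 0, 0, 0, 0, p_pow (s - r)],
     vector [0, 0, 0, p_pow (- s), 0, 0]]"
  unfolding vec_eq_iff forall_6 by (simp add: n_ab_def E_mat_def)

lemma n_ac_entries:
  "n_ac r s = vector
    [vector [1, 0, 0, 0, 0, 0],
     vector [0, 0, 0, 0, - p_pow (- r - s), 0],
     vector [0, 0, 0, 0, 0, - p_pow (s - r)],
     vector [0, 0, 0, 1, 0, 0],
     vector [0, - p_pow (r + s), 0, 0, 0, 0],
     vector [0, 0, - p_pow (r - s), 0, 0, 0]]"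
  unfolding vec_eq_iff forall_6 by (simp add: n_ac_def E_mat_def)

lemma n_ba_entries:
  "n_ba r s = vector
    [vector [0, 0, p_pow (- r), 0, 0, 0],
     vector [- p_pow (r - s), 0, 0, 0, 0, 0],
     vector [0, - p_pow s, 0, 0, 0, 0],
     vector [0, 0, 0, 0, 0, p_pow r],
     vector [0, 0, 0, - p_pow (s - r), 0, 0],
     vector [0, 0, 0, 0, - p_pow (- s), 0]]"
  unfolding vec_eq_iff forall_6 by (simp add: n_ba_def E_mat_def)

lemma n_bc_entries:
  "n_bc r s = vector
    [vector [0, 0, 0, 0, 0, p_pow (- r)],
     vector [p_pow (r - s), 0, 0, 0, 0, 0],
     vector [0, 0, 0, 0, p_pow (- s), 0],
     vector [0, 0, p_pow r, 0, 0, 0],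
     vector [0, 0, 0, p_pow (s - r), 0, 0],
     vector [0, p_pow s, 0, 0, 0, 0]]"
  unfolding vec_eq_iff forall_6 by (simp add: n_bc_def E_mat_def)

lemma n_cb_entries:
  "n_cb r s = vector
    [vector [0, p_pow (- r), 0, 0, 0, 0],
     vector [0, 0, 0, 0, 0, - p_pow (r - s)],
     vector [0, 0, 0, p_pow (- s), 0, 0],
     vector [0, 0, 0, 0, p_pow r, 0],
     vector [0, 0, - p_pow (s - r), 0, 0, 0],
     vector [p_pow s, 0, 0, 0, 0, 0]]"
  unfolding vec_eq_iff forall_6 by (simp add: n_cb_def E_mat_def)


lemma SO33_transpose:
  fixes A :: "'a::field ^ 6 ^ 6"
  assumes "A \<in> SO33"
  shows "transpose A \<in> SO33"
proof -
  have "transpose A = SO33_form ** SO33_inv A ** SO33_form"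
    by (simp add: SO33_inv_def matrix_mul_assoc SO33_form_square)
      (simp add: SO33_form_square flip: matrix_mul_assoc)
  then have "transpose A ** SO33_form ** A = SO33_form ** SO33_inv A ** (SO33_form ** SO33_form) ** A"
    by (simp add: matrix_mul_assoc)
  also have "\<dots> = SO33_form"
    by (simp add: SO33_form_square SO33_inv_cancel(4)[OF assms])
  finally show ?thesis
    using assms by (simp add: SO33_def transpose_transpose)
qed

lemma U33_mat_in_U33: "U33_mat x y z t u v \<in> U33"
  unfolding U33_def by blast

text \<open>
  The factorisation is the identity in \<open>SL_2\<close> that writes the Weyl element as an upper, a lower
  and again an upper unipotent matrix, in the copy of \<open>SL_2\<close> belonging to a simple root. The same
  identity is behind \<open>n_b\<close> and \<open>n_c\<close>.
\<close>

lemma n_a_in_SO33: "n_a r \<in> (SO33 :: ('p::prime_card padic ^ 6 ^ 6) set)"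
proof -
  have "n_a r = U33_mat 0 0 0 0 (p_pow (- r)) 0 ** transpose (U33_mat 0 0 0 0 (- p_pow r) 0)
      ** (U33_mat 0 0 0 0 (p_pow (- r)) 0 :: 'p padic ^ 6 ^ 6)"
    by (simp add: n_a_entries U33_mat_def vector_mult_6 transpose_vector_6 vector_6_eq_iff p_pow_minus)
  then show ?thesis
    by (simp add: SO33_mult SO33_transpose U33_in_SO33 U33_mat_in_U33)
qed

lemma n_b_in_SO33: "n_b r \<in> (SO33 :: ('p::prime_card padic ^ 6 ^ 6) set)"
proof -
  have "n_b r = U33_mat (p_pow (- r)) 0 0 0 0 0 ** transpose (U33_mat (- p_pow r) 0 0 0 0 0)
      ** (U33_mat (p_pow (- r)) 0 0 0 0 0 :: 'p padic ^ 6 ^ 6)"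
    by (simp add: n_b_entries U33_mat_def vector_mult_6 transpose_vector_6 vector_6_eq_iff p_pow_minus)
  then show ?thesis
    by (simp add: SO33_mult SO33_transpose U33_in_SO33 U33_mat_in_U33)
qed

lemma n_c_in_SO33: "n_c r \<in> (SO33 :: ('p::prime_card padic ^ 6 ^ 6) set)"
proof -
  have "n_c r = U33_mat 0 0 0 0 0 (- p_pow (- r)) ** transpose (U33_mat 0 0 0 0 0 (p_pow r))
      ** (U33_mat 0 0 0 0 0 (- p_pow (- r)) :: 'p padic ^ 6 ^ 6)"
    by (simp add: n_c_entries U33_mat_def vector_mult_6 transpose_vector_6 vector_6_eq_iff p_pow_minus)
  then show ?thesis
    by (simp add: SO33_mult SO33_transpose U33_in_SO33 U33_mat_in_U33)
qed

lemma n_ab_in_SO33: "n_ab r s \<in> (SO33 :: ('p::prime_card padic ^ 6 ^ 6) set)"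
proof -
  have "n_ab r s = n_a (s - r) ** (n_b r :: 'p padic ^ 6 ^ 6)"
    by (simp add: n_ab_entries n_a_entries n_b_entries vector_mult_6 vector_6_eq_iff p_pow_simps field_simps)
  then show ?thesis
    by (simp add: SO33_mult n_a_in_SO33 n_b_in_SO33)
qed

lemma n_ba_in_SO33: "n_ba r s \<in> (SO33 :: ('p::prime_card padic ^ 6 ^ 6) set)"
proof -
  have "n_ba r s = n_b (r - s) ** (n_a s :: 'p padic ^ 6 ^ 6)"
    by (simp add: n_ba_entries n_a_entries n_b_entries vector_mult_6 vector_6_eq_iff p_pow_simps field_simps)
  then show ?thesis
    by (simp add: SO33_mult n_a_in_SO33 n_b_in_SO33)
qed

lemma n_ac_in_SO33: "n_ac r s \<in> (SO33 :: ('p::prime_card padic ^ 6 ^ 6) set)"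
proof -
  have "n_ac r s = n_a 0 ** n_a 0 ** n_a s ** (n_c r :: 'p padic ^ 6 ^ 6)"
    by (simp add: n_ac_entries n_a_entries n_c_entries vector_mult_6 vector_6_eq_iff p_pow_simps field_simps)
  then show ?thesis
    by (simp add: SO33_mult n_a_in_SO33 n_c_in_SO33)
qed

lemma U33_bar_id: "U33_bar (mat 1 :: 'p::prime_card padic ^ 6 ^ 6) = {mat 1}"
proof (intro equalityI subsetI)
  fix w assume "w \<in> U33_bar (mat 1 :: 'p padic ^ 6 ^ 6)"
  then show "w \<in> {mat 1}"
    using U33_Int_opposite[of w] by (auto simp: U33_bar_iff[OF SO33_one] transpose_transpose)
qed (simp add: U33_bar_one SO33_one)

text \<open>
  Conjugation by \<open>n\<close> moves every root subgroup to another one. The parameters of \<open>U33_bar n\<close> are those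
  of the positive roots that become negative. All other parameters must vanish, because the
  corresponding entries of the elements of the opposite group do.
\<close>

lemma U33_bar_n_a:
  "U33_bar (n_a r :: 'p::prime_card padic ^ 6 ^ 6) = {U33_mat 0 0 0 0 u 0 | u. True}"
proof (intro equalityI subsetI)
  fix w assume w: "w \<in> U33_bar (n_a r :: 'p padic ^ 6 ^ 6)"
  obtain x y z t u v where w_eq: "w = U33_mat x y z t u v"
    using w by (auto simp: U33_bar_iff[OF n_a_in_SO33] U33_def)
  obtain x' y' z' t' u' v' where eq: "n_a r ** w = transpose (U33_mat x' y' z' t' u' v') ** n_a r"
    using w by (auto simp: U33_bar_iff[OF n_a_in_SO33] U33_def)
  have "w = U33_mat 0 0 0 0 u 0"
    using eq unfolding w_eq U33_mat_eq_iff
    by (simp add: n_a_entries U33_mat_def vector_mult_6 transpose_vector_6 vector_6_eq_iff)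
  then show "w \<in> {U33_mat 0 0 0 0 u 0 | u. True}"
    by blast
next
  fix w :: "'p padic ^ 6 ^ 6" assume "w \<in> {U33_mat 0 0 0 0 u 0 | u. True}"
  then obtain u where w: "w = (U33_mat 0 0 0 0 u 0 :: 'p padic ^ 6 ^ 6)"
    by blast
  have "n_a r ** w = transpose (U33_mat 0 0 0 0 (- (p_pow r ^ 2) * u) 0) ** n_a r"
    by (simp add: w n_a_entries U33_mat_def vector_mult_6 transpose_vector_6 vector_6_eq_iff
        p_pow_simps field_simps power2_eq_square)
  then show "w \<in> U33_bar (n_a r)"
    unfolding U33_bar_iff[OF n_a_in_SO33] unfolding w U33_def by blast
qed

lemma U33_bar_n_b:
  "U33_bar (n_b r :: 'p::prime_card padic ^ 6 ^ 6) = {U33_mat x 0 0 0 0 0 | x. True}"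
proof (intro equalityI subsetI)
  fix w assume w: "w \<in> U33_bar (n_b r :: 'p padic ^ 6 ^ 6)"
  obtain x y z t u v where w_eq: "w = U33_mat x y z t u v"
    using w by (auto simp: U33_bar_iff[OF n_b_in_SO33] U33_def)
  obtain x' y' z' t' u' v' where eq: "n_b r ** w = transpose (U33_mat x' y' z' t' u' v') ** n_b r"
    using w by (auto simp: U33_bar_iff[OF n_b_in_SO33] U33_def)
  have "w = U33_mat x 0 0 0 0 0"
    using eq unfolding w_eq U33_mat_eq_iff
    by (simp add: n_b_entries U33_mat_def vector_mult_6 transpose_vector_6 vector_6_eq_iff)
  then show "w \<in> {U33_mat x 0 0 0 0 0 | x. True}"
    by blast
next
  fix w :: "'p padic ^ 6 ^ 6" assume "w \<in> {U33_mat x 0 0 0 0 0 | x. True}"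
  then obtain x where w: "w = (U33_mat x 0 0 0 0 0 :: 'p padic ^ 6 ^ 6)"
    by blast
  have "n_b r ** w = transpose (U33_mat (- (p_pow r ^ 2) * x) 0 0 0 0 0) ** n_b r"
    by (simp add: w n_b_entries U33_mat_def vector_mult_6 transpose_vector_6 vector_6_eq_iff
        p_pow_simps field_simps power2_eq_square)
  then show "w \<in> U33_bar (n_b r)"
    unfolding U33_bar_iff[OF n_b_in_SO33] unfolding w U33_def by blast
qed

lemma U33_bar_n_ab:
  "U33_bar (n_ab r s :: 'p::prime_card padic ^ 6 ^ 6) = {U33_mat x y 0 0 0 0 | x y. True}"
proof (intro equalityI subsetI)
  fix w assume w: "w \<in> U33_bar (n_ab r s :: 'p padic ^ 6 ^ 6)"
  obtain x y z t u v where w_eq: "w = U33_mat x y z t u v"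
    using w by (auto simp: U33_bar_iff[OF n_ab_in_SO33] U33_def)
  obtain x' y' z' t' u' v' where eq: "n_ab r s ** w = transpose (U33_mat x' y' z' t' u' v') ** n_ab r s"
    using w by (auto simp: U33_bar_iff[OF n_ab_in_SO33] U33_def)
  have "w = U33_mat x y 0 0 0 0"
    using eq unfolding w_eq U33_mat_eq_iff
    by (simp add: n_ab_entries U33_mat_def vector_mult_6 transpose_vector_6 vector_6_eq_iff)
  then show "w \<in> {U33_mat x y 0 0 0 0 | x y. True}"
    by blast
next
  fix w :: "'p padic ^ 6 ^ 6" assume "w \<in> {U33_mat x y 0 0 0 0 | x y. True}"
  then obtain x y where w: "w = (U33_mat x y 0 0 0 0 :: 'p padic ^ 6 ^ 6)"
    by blast
  have "n_ab r s ** w = transpose (U33_mat 0 (p_pow s * p_pow r * x) 0 0 (p_pow s ^ 2 / p_pow r * y) 0) ** n_ab r s"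
    by (simp add: w n_ab_entries U33_mat_def vector_mult_6 transpose_vector_6 vector_6_eq_iff
        p_pow_simps field_simps power2_eq_square)
  then show "w \<in> U33_bar (n_ab r s)"
    unfolding U33_bar_iff[OF n_ab_in_SO33] unfolding w U33_def by blast
qed

lemma U33_bar_n_ba:
  "U33_bar (n_ba r s :: 'p::prime_card padic ^ 6 ^ 6) = {U33_mat 0 y 0 0 u 0 | y u. True}"
proof (intro equalityI subsetI)
  fix w assume w: "w \<in> U33_bar (n_ba r s :: 'p padic ^ 6 ^ 6)"
  obtain x y z t u v where w_eq: "w = U33_mat x y z t u v"
    using w by (auto simp: U33_bar_iff[OF n_ba_in_SO33] U33_def)
  obtain x' y' z' t' u' v' where eq: "n_ba r s ** w = transpose (U33_mat x' y' z' t' u' v') ** n_ba r s"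
    using w by (auto simp: U33_bar_iff[OF n_ba_in_SO33] U33_def)
  have "w = U33_mat 0 y 0 0 u 0"
    using eq unfolding w_eq U33_mat_eq_iff
    by (simp add: n_ba_entries U33_mat_def vector_mult_6 transpose_vector_6 vector_6_eq_iff)
  then show "w \<in> {U33_mat 0 y 0 0 u 0 | y u. True}"
    by blast
next
  fix w :: "'p padic ^ 6 ^ 6" assume "w \<in> {U33_mat 0 y 0 0 u 0 | y u. True}"
  then obtain y u where w: "w = (U33_mat 0 y 0 0 u 0 :: 'p padic ^ 6 ^ 6)"
    by blast
  have "n_ba r s ** w = transpose (U33_mat (- (p_pow r ^ 2 / p_pow s) * y) (- (p_pow r * p_pow s) * u) 0 0 0 0) ** n_ba r s"
    by (simp add: w n_ba_entries U33_mat_def vector_mult_6 transpose_vector_6 vector_6_eq_iff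
        p_pow_simps field_simps power2_eq_square)
  then show "w \<in> U33_bar (n_ba r s)"
    unfolding U33_bar_iff[OF n_ba_in_SO33] unfolding w U33_def by blast
qed

lemma U33_bar_n_ac:
  "U33_bar (n_ac r s :: 'p::prime_card padic ^ 6 ^ 6) = {U33_mat 0 0 0 0 u v | u v. True}"
proof (intro equalityI subsetI)
  fix w assume w: "w \<in> U33_bar (n_ac r s :: 'p padic ^ 6 ^ 6)"
  obtain x y z t u v where w_eq: "w = U33_mat x y z t u v"
    using w by (auto simp: U33_bar_iff[OF n_ac_in_SO33] U33_def)
  obtain x' y' z' t' u' v' where eq: "n_ac r s ** w = transpose (U33_mat x' y' z' t' u' v') ** n_ac r s"
    using w by (auto simp: U33_bar_iff[OF n_ac_in_SO33] U33_def)
  have "w = U33_mat 0 0 0 0 u v"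
    using eq unfolding w_eq U33_mat_eq_iff
    by (simp add: n_ac_entries U33_mat_def vector_mult_6 transpose_vector_6 vector_6_eq_iff)
  then show "w \<in> {U33_mat 0 0 0 0 u v | u v. True}"
    by blast
next
  fix w :: "'p padic ^ 6 ^ 6" assume "w \<in> {U33_mat 0 0 0 0 u v | u v. True}"
  then obtain u v where w: "w = (U33_mat 0 0 0 0 u v :: 'p padic ^ 6 ^ 6)"
    by blast
  have "n_ac r s ** w = transpose (U33_mat 0 0 0 0 (- (p_pow s ^ 2) * u) (- (p_pow r ^ 2) * v)) ** n_ac r s"
    by (simp add: w n_ac_entries U33_mat_def vector_mult_6 transpose_vector_6 vector_6_eq_iff
        p_pow_simps field_simps power2_eq_square)
  then show "w \<in> U33_bar (n_ac r s)"
    unfolding U33_bar_iff[OF n_ac_in_SO33] unfolding w U33_def by blast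
qed

section \<open>Representatives for the identity and the simple reflections\<close>

lemma inverse_witness:
  assumes "coprime d (int CARD('p::prime_card) ^ k)"
  obtains l where "of_int (modular_inverse (int CARD('p) ^ k) d) * of_int d = 1 + pp ^ k * (of_int l :: 'p padic)"
proof -
  have "int CARD('p) ^ k dvd modular_inverse (int CARD('p) ^ k) d * d - 1"
    using cong_modular_inverse2[of d "int CARD('p) ^ k"] assms
    by (simp add: cong_iff_dvd_diff coprime_commute)
  then obtain l where "modular_inverse (int CARD('p) ^ k) d * d - 1 = int CARD('p) ^ k * l" ..
  then have "modular_inverse (int CARD('p) ^ k) d * d = 1 + int CARD('p) ^ k * l"
    by simp
  then have "(of_int (modular_inverse (int CARD('p) ^ k) d * d) :: 'p padic) = of_int (1 + int CARD('p) ^ k * l)"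
    by (rule arg_cong)
  then show thesis
    by (intro that[of l]) simp
qed

text \<open>
  Used with rows \<open>i\<close> and \<open>k\<close> that are dual for the form, this says that row \<open>i\<close> of an integral \<open>g\<close> is
  primitive.
\<close>

lemma SO33_pairing:
  assumes "g \<in> SO33"
  shows "g $ i $ 1 * g $ k $ 4 + g $ i $ 2 * g $ k $ 5 + g $ i $ 3 * g $ k $ 6
    + g $ i $ 4 * g $ k $ 1 + g $ i $ 5 * g $ k $ 2 + g $ i $ 6 * g $ k $ 3 = SO33_form $ i $ k"
proof -
  have "(g ** SO33_form ** transpose g) $ i $ k = SO33_form $ i $ k"
    using assms by (simp add: SO33_def)
  moreover have "(g ** SO33_form ** transpose g) $ i $ k
    = g $ i $ 1 * g $ k $ 4 + g $ i $ 2 * g $ k $ 5 + g $ i $ 3 * g $ k $ 6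
    + g $ i $ 4 * g $ k $ 1 + g $ i $ 5 * g $ k $ 2 + g $ i $ 6 * g $ k $ 3"
    by (simp add: matrix_mult_6 transpose_entry) (simp add: SO33_form_def)
  ultimately show ?thesis by simp
qed

lemma integral_U33_mat_iff:
  "U33_mat x y z t u v \<in> integral_points H \<longleftrightarrow> U33_mat x y z t u v \<in> H \<and>
     {x, y, z, t, u, v} \<subseteq> (padic_ints :: 'p::prime_card padic set)"
proof -
  have "integral_mat (U33_mat x y z t u v) \<longleftrightarrow> {x, y, z, t, u, v} \<subseteq> padic_ints"
  proof
    assume int: "integral_mat (U33_mat x y z t u v)"
    have entries: "U33_mat x y z t u v $ i $ j \<in> padic_ints" for i j
      using int by (simp add: integral_mat_def)
    show "{x, y, z, t, u, v} \<subseteq> padic_ints"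
      using entries[of 1 2] entries[of 1 3] entries[of 1 5] entries[of 1 6] entries[of 2 3] entries[of 2 6]
      by (simp add: U33_mat_def)
  next
    assume "{x, y, z, t, u, v} \<subseteq> padic_ints"
    then show "integral_mat (U33_mat x y z t u v)"
      by (simp add: integral_mat_def forall_6 U33_mat_def)
  qed
  then show ?thesis
    using U33_in_SO33[OF U33_mat_in_U33] by (auto simp: integral_points_iff)
qed

text \<open>
  The form in which a parameter of \<open>w\<close> is replaced by an integer: \<open>X\<close> is the parameter with its
  denominator cleared, the first assumption comes from a primitive row or vector of minors, and the
  modulus \<open>p ^ k\<close> of the residue may be larger than the modulus \<open>p ^ j\<close> of the coprimality condition.
\<close>

lemma coprime_residueE:
  assumes "1 = pp ^ j * A + X * B" "j \<le> k"
    and "A \<in> (padic_ints :: 'p::prime_card padic set)" "B \<in> padic_ints" "X \<in> padic_ints"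
  obtains a Y where "a \<in> {0..<int CARD('p) ^ k}" "coprime a (int CARD('p) ^ j)"
    "Y \<in> padic_ints" "X = of_int a + pp ^ k * Y"
proof -
  obtain a Y where a: "0 \<le> a" "a < int CARD('p) ^ k" "Y \<in> padic_ints" "X = of_int a + pp ^ k * Y"
    using padic_ints_residue[OF assms(5)] .
  have k: "pp ^ k = pp ^ j * (pp ^ (k - j) :: 'p padic)"
    using assms(2) by (simp flip: power_add)
  have "1 = pp ^ j * (A + pp ^ (k - j) * Y * B) + of_int a * B"
    using assms(1) unfolding a(4) k by (simp only: algebra_simps)
  then have "coprime a (int CARD('p) ^ j)"
    by (rule coprime_residue) (use a assms in auto)
  with a show thesis
    by (intro that) auto
qed

abbreviation unit_residues :: "'p::prime_card itself \<Rightarrow> nat \<Rightarrow> int set" where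
  "unit_residues p r \<equiv> {d. d \<in> {0..<int CARD('p) ^ r} \<and> coprime d (int CARD('p) ^ r)}"

lemma bruhat_reps_n_id: "bruhat_reps (n_id :: 'p::prime_card padic ^ 6 ^ 6) {()} (\<lambda>_. mat 1) (\<lambda>_. mat 1)"
  unfolding bruhat_reps_def n_id_def U33_bar_id
  by (auto simp: SO33_one U33_one integral_mat_one integral_points_iff)

text \<open>
  In \<open>SL_2\<close> this is the product of \<open>(1, c/q; 0, 1)\<close>, \<open>(0, 1/q; -q, 0)\<close> and \<open>(1, d/q; 0, 1)\<close> for
  \<open>q = p ^ r\<close>, which is \<open>(-c, (1 - c d)/q; -q, -d)\<close>. For integers \<open>c\<close> and \<open>d\<close> it is
  integral exactly when \<open>c\<close> is an inverse of \<open>d\<close> modulo \<open>q\<close>. This is where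
  the inverses in the Kloosterman sums come from.
\<close>

lemma n_a_integral_product:
  fixes c d k :: "'p::prime_card padic"
  assumes "c * d = 1 + p_pow r * k"
  shows "U33_mat 0 0 0 0 (c / p_pow r) 0 ** n_a r ** U33_mat 0 0 0 0 (d / p_pow r) 0 = vector
    [vector [1, 0, 0, 0, 0, 0],
     vector [0, - c, - k, 0, 0, 0],
     vector [0, - p_pow r, - d, 0, 0, 0],
     vector [0, 0, 0, 1, 0, 0],
     vector [0, 0, 0, 0, - d, p_pow r],
     vector [0, 0, 0, 0, k, - c]]"
  using assms
  by (simp add: n_a_entries U33_mat_def vector_mult_6 vector_6_eq_iff p_pow_simps field_simps)

text \<open>
  For integral \<open>g = u n w\<close> the fifth row of \<open>g\<close> contains \<open>- p ^ r v\<close> and \<open>p ^ r\<close>, where \<open>v\<close> is the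
  parameter of \<open>w\<close>; being primitive, it makes \<open>p ^ r v\<close> a unit modulo \<open>p ^ r\<close>.
\<close>

lemma bruhat_reps_n_a:
  "bruhat_reps (n_a (int r) :: 'p::prime_card padic ^ 6 ^ 6) (unit_residues TYPE('p) r)
     (\<lambda>d. U33_mat 0 0 0 0 (of_int (modular_inverse (int CARD('p) ^ r) d) / pp ^ r) 0)
     (\<lambda>d. U33_mat 0 0 0 0 (of_int d / pp ^ r) 0)"
proof -
  let ?q = "int CARD('p) ^ r" and ?n = "n_a (int r) :: 'p padic ^ 6 ^ 6"
  let ?b = "\<lambda>d. U33_mat 0 0 0 0 (of_int d / pp ^ r) 0 :: 'p padic ^ 6 ^ 6"
  have "integral_mat (U33_mat 0 0 0 0 (of_int (modular_inverse ?q d) / pp ^ r) 0 ** ?n ** ?b d)"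
    if d: "coprime d ?q" for d
  proof -
    obtain l where "of_int (modular_inverse ?q d) * of_int d = 1 + pp ^ r * (of_int l :: 'p padic)"
      using inverse_witness[OF d] .
    from n_a_integral_product[of _ _ "int r", unfolded p_pow_of_nat, OF this] show ?thesis
      by (simp add: integral_mat_def forall_6)
  qed
  moreover have "i = j" if ij: "i \<in> unit_residues TYPE('p) r" "j \<in> unit_residues TYPE('p) r"
    "k \<in> integral_points (U33_bar ?n)" "?b j = ?b i ** k" for i j k
  proof -
    obtain u where k: "k = U33_mat 0 0 0 0 u 0"
      using ij(3) by (auto simp: integral_points_iff U33_bar_n_a)
    then have "u \<in> padic_ints"
      using ij(3) by (simp add: integral_U33_mat_iff)
    moreover have "(of_int j - of_int i) / pp ^ r = u"
      using ij(4) by (simp add: k U33_mat_mult U33_mat_eq_iff diff_divide_distrib)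
    ultimately have "j = i"
      using ij(1,2) residue_unique[of j i r, where 'p = 'p] by auto
    then show ?thesis ..
  qed
  moreover have "\<exists>d\<in>unit_residues TYPE('p) r. \<exists>k\<in>integral_points (U33_bar ?n). w = ?b d ** k"
    if u: "u \<in> U33" and w: "w \<in> U33_bar ?n" and int: "integral_mat (u ** ?n ** w)" for u w
  proof -
    obtain x y z t c f where u_eq: "u = U33_mat x y z t c f"
      using u by (auto simp: U33_def)
    obtain v where w_eq: "w = U33_mat 0 0 0 0 v 0"
      using w by (auto simp: U33_bar_n_a)
    define g where "g = u ** ?n ** w"
    have g_int: "g $ i $ j \<in> padic_ints" for i j
      using int by (simp add: g_def integral_mat_def)
    have g: "g $ 5 $ 1 = 0" "g $ 5 $ 2 = 0" "g $ 5 $ 3 = 0" "g $ 5 $ 5 = - (pp ^ r * v)" "g $ 5 $ 6 = pp ^ r"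
        "g $ 2 $ 1 = 0"
      by (simp_all add: g_def u_eq w_eq matrix_mult_6) 
         (simp_all add: n_a_entries U33_mat_def p_pow_simps p_pow_of_nat)
    have "1 = pp ^ r * g $ 2 $ 3 + (pp ^ r * v) * (- g $ 2 $ 2)"
      using SO33_pairing[OF U33_mult_n_bar_in_SO33[OF u n_a_in_SO33 w], of 5 2, folded g_def]
      by (simp add: g SO33_form_def)
    then obtain d Y where d: "d \<in> {0..<?q}" "coprime d ?q" "Y \<in> padic_ints" "pp ^ r * v = of_int d + pp ^ r * Y"
      by (rule coprime_residueE[where k = r]) (use g_int[of 5 5] g_int in \<open>auto simp: g\<close>)
    have "w = ?b d ** U33_mat 0 0 0 0 Y 0"
      using d(4) by (simp add: w_eq U33_mat_mult U33_mat_eq_iff field_simps)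
    moreover have "U33_mat 0 0 0 0 Y 0 \<in> integral_points (U33_bar ?n)"
      using d by (auto simp: integral_U33_mat_iff U33_bar_n_a)
    ultimately show ?thesis
      using d by auto
  qed
  ultimately show ?thesis
    unfolding bruhat_reps_def by (auto simp: n_a_in_SO33 U33_mat_in_U33 U33_bar_n_a)
qed

lemma n_b_integral_product:
  fixes c d k :: "'p::prime_card padic"
  assumes "c * d = 1 + p_pow r * k"
  shows "U33_mat (c / p_pow r) 0 0 0 0 0 ** n_b r ** U33_mat (d / p_pow r) 0 0 0 0 0 = vector
    [vector [- c, - k, 0, 0, 0, 0],
     vector [- p_pow r, - d, 0, 0, 0, 0],
     vector [0, 0, 1, 0, 0, 0],
     vector [0, 0, 0, - d, p_pow r, 0],
     vector [0, 0, 0, k, - c, 0],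
     vector [0, 0, 0, 0, 0, 1]]"
  using assms
  by (simp add: n_b_entries U33_mat_def vector_mult_6 vector_6_eq_iff p_pow_simps field_simps)

text \<open>
  As for \<open>n_a\<close>, with the fourth row of \<open>g\<close> in the place of the fifth.
\<close>

lemma bruhat_reps_n_b:
  "bruhat_reps (n_b (int r) :: 'p::prime_card padic ^ 6 ^ 6) (unit_residues TYPE('p) r)
     (\<lambda>d. U33_mat (of_int (modular_inverse (int CARD('p) ^ r) d) / pp ^ r) 0 0 0 0 0)
     (\<lambda>d. U33_mat (of_int d / pp ^ r) 0 0 0 0 0)"
proof -
  let ?q = "int CARD('p) ^ r" and ?n = "n_b (int r) :: 'p padic ^ 6 ^ 6"
  let ?b = "\<lambda>d. U33_mat (of_int d / pp ^ r) 0 0 0 0 0 :: 'p padic ^ 6 ^ 6"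
  have "integral_mat (U33_mat (of_int (modular_inverse ?q d) / pp ^ r) 0 0 0 0 0 ** ?n ** ?b d)"
    if d: "coprime d ?q" for d
  proof -
    obtain l where "of_int (modular_inverse ?q d) * of_int d = 1 + pp ^ r * (of_int l :: 'p padic)"
      using inverse_witness[OF d] .
    from n_b_integral_product[of _ _ "int r", unfolded p_pow_of_nat, OF this] show ?thesis
      by (simp add: integral_mat_def forall_6)
  qed
  moreover have "i = j" if ij: "i \<in> unit_residues TYPE('p) r" "j \<in> unit_residues TYPE('p) r"
    "k \<in> integral_points (U33_bar ?n)" "?b j = ?b i ** k" for i j k
  proof -
    obtain u where k: "k = U33_mat u 0 0 0 0 0"
      using ij(3) by (auto simp: integral_points_iff U33_bar_n_b)
    then have "u \<in> padic_ints"
      using ij(3) by (simp add: integral_U33_mat_iff)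
    moreover have "(of_int j - of_int i) / pp ^ r = u"
      using ij(4) by (simp add: k U33_mat_mult U33_mat_eq_iff diff_divide_distrib)
    ultimately have "j = i"
      using ij(1,2) residue_unique[of j i r, where 'p = 'p] by auto
    then show ?thesis ..
  qed
  moreover have "\<exists>d\<in>unit_residues TYPE('p) r. \<exists>k\<in>integral_points (U33_bar ?n). w = ?b d ** k"
    if u: "u \<in> U33" and w: "w \<in> U33_bar ?n" and int: "integral_mat (u ** ?n ** w)" for u w
  proof -
    obtain x y z t c f where u_eq: "u = U33_mat x y z t c f"
      using u by (auto simp: U33_def)
    obtain v where w_eq: "w = U33_mat v 0 0 0 0 0"
      using w by (auto simp: U33_bar_n_b)
    define g where "g = u ** ?n ** w"
    have g_int: "g $ i $ j \<in> padic_ints" for i j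
      using int by (simp add: g_def integral_mat_def)
    have g: "g $ 4 $ 1 = 0" "g $ 4 $ 2 = 0" "g $ 4 $ 3 = 0" "g $ 4 $ 4 = - (pp ^ r * v)" "g $ 4 $ 5 = pp ^ r"
        "g $ 4 $ 6 = 0"
      by (simp_all add: g_def u_eq w_eq matrix_mult_6)
         (simp_all add: n_b_entries U33_mat_def p_pow_simps p_pow_of_nat)
    have "1 = pp ^ r * g $ 1 $ 2 + (pp ^ r * v) * (- g $ 1 $ 1)"
      using SO33_pairing[OF U33_mult_n_bar_in_SO33[OF u n_b_in_SO33 w], of 4 1, folded g_def]
      by (simp add: g SO33_form_def)
    then obtain d Y where d: "d \<in> {0..<?q}" "coprime d ?q" "Y \<in> padic_ints" "pp ^ r * v = of_int d + pp ^ r * Y"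
      by (rule coprime_residueE[where k = r]) (use g_int[of 4 4] g_int in \<open>auto simp: g\<close>)
    have "w = ?b d ** U33_mat Y 0 0 0 0 0"
      using d(4) by (simp add: w_eq U33_mat_mult U33_mat_eq_iff field_simps)
    moreover have "U33_mat Y 0 0 0 0 0 \<in> integral_points (U33_bar ?n)"
      using d by (auto simp: integral_U33_mat_iff U33_bar_n_b)
    ultimately show ?thesis
      using d by auto
  qed
  ultimately show ?thesis
    unfolding bruhat_reps_def by (auto simp: n_b_in_SO33 U33_mat_in_U33 U33_bar_n_b)
qed

section \<open>Representatives for products of two simple reflections\<close>

abbreviation kl_S3_indices :: "'p::prime_card itself \<Rightarrow> nat \<Rightarrow> nat \<Rightarrow> (int \<times> int) set" where
  "kl_S3_indices p r s \<equiv> unit_residues p r \<times>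
     {y. y \<in> {0..<int CARD('p) ^ s} \<and> coprime y (int CARD('p) ^ (s - r))}"

lemma bruhat_reps_pairI:
  fixes n :: "'p::prime_card padic ^ 6 ^ 6"
  assumes "n \<in> SO33"
    and "\<And>x y. (x, y) \<in> I \<Longrightarrow> a x y \<in> U33"
    and "\<And>x y. (x, y) \<in> I \<Longrightarrow> b x y \<in> U33_bar n"
    and "\<And>x y. (x, y) \<in> I \<Longrightarrow> integral_mat (a x y ** n ** b x y)"
    and "\<And>x y x' y' k. (x, y) \<in> I \<Longrightarrow> (x', y') \<in> I \<Longrightarrow> k \<in> integral_points (U33_bar n) \<Longrightarrow>
      b x' y' = b x y ** k \<Longrightarrow> x = x' \<and> y = y'"
    and "\<And>u w. u \<in> U33 \<Longrightarrow> w \<in> U33_bar n \<Longrightarrow> integral_mat (u ** n ** w) \<Longrightarrow>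
      \<exists>x y. (x, y) \<in> I \<and> (\<exists>k\<in>integral_points (U33_bar n). w = b x y ** k)"
  shows "bruhat_reps n I (\<lambda>(x, y). a x y) (\<lambda>(x, y). b x y)"
  unfolding bruhat_reps_def
proof (intro conjI ballI impI)
  fix u w assume "u \<in> U33" "w \<in> U33_bar n" "integral_mat (u ** n ** w)"
  then obtain x y k where "(x, y) \<in> I" "k \<in> integral_points (U33_bar n)" "w = b x y ** k"
    using assms(6) by blast
  then show "\<exists>i\<in>I. \<exists>k\<in>integral_points (U33_bar n). w = (case i of (x, y) \<Rightarrow> b x y) ** k"
    by (intro bexI[of _ "(x, y)"] bexI[of _ k]) simp_all
next
  fix i j k assume "i \<in> I" "j \<in> I" "k \<in> integral_points (U33_bar n)"
    "(case j of (x, y) \<Rightarrow> b x y) = (case i of (x, y) \<Rightarrow> b x y) ** k"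
  then show "i = j"
    using assms(5)[of "fst i" "snd i" "fst j" "snd j" k] by (simp add: case_prod_unfold prod_eq_iff)
qed (use assms(1-4) in \<open>auto split: prod.splits\<close>)

text \<open>
  In the upper left block the second row of the product forces the entry \<open>y'/D\<close> of the left factor,
  and the first row then forces the other two, up to integers.
\<close>

lemma n_ab_integral_product:
  fixes x x' y y' k l P D :: "'p::prime_card padic"
  assumes "x' * x = 1 + P * k" "y' * y = 1 + D * l"
    and "P = p_pow r" "P * D = p_pow s"
  shows "U33_mat (x' * y / P) (x' / (P * D)) 0 0 (y' / D) 0 ** n_ab r s
      ** U33_mat (- x / P) (- y / (P * D)) 0 0 0 0 = vector
    [vector [x', - k, 0, 0, 0, 0],
     vector [y' * P, - (y' * x), - l, 0, 0, 0],
     vector [P * D, - (D * x), - y, 0, 0, 0],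
     vector [0, 0, 0, x, P, 0],
     vector [0, 0, 0, - (y * k), - (x' * y), D],
     vector [0, 0, 0, l * k, x' * l, - y']]"
proof -
  have nz: "P \<noteq> 0" "D \<noteq> 0"
    using assms(3,4) p_pow_nonzero[of r, where 'p = 'p] p_pow_nonzero[of s, where 'p = 'p] by auto
  have k: "k = (x' * x - 1) / P" and l: "l = (y' * y - 1) / D"
    using assms(1,2) nz by (simp_all add: field_simps)
  show ?thesis
    unfolding k l
    by (simp add: n_ab_entries U33_mat_def vector_mult_6 vector_6_eq_iff p_pow_simps nz field_simps
        flip: assms(3,4))
qed

text \<open>
  The fourth row of \<open>g\<close> is \<open>p ^ r\<close> times \<open>(-x, 1, 0)\<close> in its last three entries, so \<open>p ^ r x\<close> is a
  unit modulo \<open>p ^ r\<close>. The third row is \<open>p ^ s\<close> times \<open>(1, x, y)\<close> in its first three entries; the first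
  two of these are divisible by \<open>p ^ (s - r)\<close>, so \<open>p ^ s y\<close> is a unit modulo \<open>p ^ (s - r)\<close>. The
  representatives carry minus signs so that the resulting sum has the signs of \<^const>\<open>kl_S3\<close>.
\<close>

lemma bruhat_reps_n_ab:
  assumes rs: "r \<le> s"
  shows "bruhat_reps (n_ab (int r) (int s) :: 'p::prime_card padic ^ 6 ^ 6) (kl_S3_indices TYPE('p) r s)
     (\<lambda>(x, y). U33_mat (of_int (modular_inverse (int CARD('p) ^ r) x) * of_int y / pp ^ r)
        (of_int (modular_inverse (int CARD('p) ^ r) x) / pp ^ s) 0 0
        (of_int (modular_inverse (int CARD('p) ^ (s - r)) y) / pp ^ (s - r)) 0)
     (\<lambda>(x, y). U33_mat (- of_int x / pp ^ r) (- of_int y / pp ^ s) 0 0 0 0)"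
proof -
  let ?P = "int CARD('p) ^ r" and ?D = "int CARD('p) ^ (s - r)" and ?n = "n_ab (int r) (int s) :: 'p padic ^ 6 ^ 6"
  let ?I = "kl_S3_indices TYPE('p) r s"
  let ?b = "\<lambda>x y. U33_mat (- of_int x / pp ^ r) (- of_int y / pp ^ s) 0 0 0 0 :: 'p padic ^ 6 ^ 6"
  have PD: "pp ^ s = pp ^ r * (pp ^ (s - r) :: 'p padic)"
    using rs by (simp flip: power_add)
  have integral: "integral_mat (U33_mat (of_int (modular_inverse ?P x) * of_int y / pp ^ r)
      (of_int (modular_inverse ?P x) / pp ^ s) 0 0 (of_int (modular_inverse ?D y) / pp ^ (s - r)) 0
      ** ?n ** ?b x y)"
    if "(x, y) \<in> ?I" for x y
  proof -
    have xy: "coprime x ?P" "coprime y ?D"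
      using that by simp_all
    obtain k where k: "of_int (modular_inverse ?P x) * of_int x = 1 + pp ^ r * (of_int k :: 'p padic)"
      using inverse_witness[OF xy(1)] .
    obtain l where l: "of_int (modular_inverse ?D y) * of_int y = 1 + pp ^ (s - r) * (of_int l :: 'p padic)"
      using inverse_witness[OF xy(2)] .
    from n_ab_integral_product[OF k l, of "int r" "int s", unfolded p_pow_of_nat, OF refl PD[symmetric]] show ?thesis
      by (simp add: integral_mat_def forall_6 PD)
  qed
  have unique: "i = j \<and> i' = j'" if ij: "(i, i') \<in> ?I" "(j, j') \<in> ?I"
    "k \<in> integral_points (U33_bar ?n)" "?b j j' = ?b i i' ** k" for i i' j j' k
  proof -
    obtain x y where k: "k = U33_mat x y 0 0 0 0"
      using ij(3) by (auto simp: integral_points_iff U33_bar_n_ab)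
    then have "x \<in> padic_ints" "y \<in> padic_ints"
      using ij(3) by (simp_all add: integral_U33_mat_iff)
    moreover have "x = - of_int j / pp ^ r - - of_int i / pp ^ r" "y = - of_int j' / pp ^ s - - of_int i' / pp ^ s"
      using ij(4) by (simp_all add: k U33_mat_mult U33_mat_eq_iff)
    then have "(of_int i - of_int j) / pp ^ r = x" "(of_int i' - of_int j') / pp ^ s = y"
      by (simp_all add: diff_divide_distrib)
    ultimately show ?thesis
      using ij(1,2) residue_unique[of i j r, where 'p = 'p] residue_unique[of i' j' s, where 'p = 'p] by auto
  qed
  have cover: "\<exists>x y. (x, y) \<in> ?I \<and> (\<exists>k\<in>integral_points (U33_bar ?n). w = ?b x y ** k)"
    if u: "u \<in> U33" and w: "w \<in> U33_bar ?n" and int: "integral_mat (u ** ?n ** w)" for u w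
  proof -
    obtain a b z t c f where u_eq: "u = U33_mat a b z t c f"
      using u by (auto simp: U33_def)
    obtain x y where w_eq: "w = U33_mat x y 0 0 0 0"
      using w by (auto simp: U33_bar_n_ab)
    define g where "g = u ** ?n ** w"
    have g_int: "g $ i $ j \<in> padic_ints" for i j
      using int by (simp add: g_def integral_mat_def)
    have g: "g $ 4 $ 1 = 0" "g $ 4 $ 2 = 0" "g $ 4 $ 3 = 0" "g $ 4 $ 4 = - (pp ^ r * x)"
        "g $ 4 $ 5 = pp ^ r" "g $ 4 $ 6 = 0"
        "g $ 3 $ 1 = pp ^ s" "g $ 3 $ 2 = pp ^ s * x" "g $ 3 $ 3 = pp ^ s * y"
        "g $ 6 $ 1 = 0" "g $ 6 $ 2 = 0" "g $ 6 $ 3 = 0"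
      by (simp_all add: g_def u_eq w_eq matrix_mult_6)
         (simp_all add: n_ab_entries U33_mat_def p_pow_simps p_pow_of_nat)
    note pairing = SO33_pairing[OF U33_mult_n_bar_in_SO33[OF u n_ab_in_SO33 w], folded g_def]
    have "1 = pp ^ r * g $ 1 $ 2 + - (pp ^ r * x) * g $ 1 $ 1"
      using pairing[of 4 1] by (simp add: g SO33_form_def)
    then obtain i Y where i: "i \<in> {0..<?P}" "coprime i ?P" "Y \<in> padic_ints"
        "- (pp ^ r * x) = of_int i + pp ^ r * Y"
      by (rule coprime_residueE[where k = r]) (use g_int[of 4 4] g_int in \<open>auto simp: g\<close>)
    \<comment> \<open>In row 3 the second entry \<open>p ^ s x\<close> is \<open>- p ^ (s - r)\<close> times the integral entry of row 4 in column 4.\<close>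
    have "1 = pp ^ (s - r) * (pp ^ r * g $ 6 $ 4 - g $ 4 $ 4 * g $ 6 $ 5) + - (pp ^ s * y) * (- g $ 6 $ 6)"
      using pairing[of 3 6] by (simp add: g SO33_form_def PD algebra_simps)
    then obtain i' Y' where i': "i' \<in> {0..<int CARD('p) ^ s}" "coprime i' ?D" "Y' \<in> padic_ints"
        "- (pp ^ s * y) = of_int i' + pp ^ s * Y'"
      by (rule coprime_residueE[where k = s]) (use g_int[of 3 3] g_int[of 4 4] g_int in \<open>auto simp: g\<close>)
    have "x = - (of_int i + pp ^ r * Y) / pp ^ r" "y = - (of_int i' + pp ^ s * Y') / pp ^ s"
      by (simp_all flip: i(4) i'(4))
    then have "w = ?b i i' ** U33_mat (- Y) (- Y') 0 0 0 0"
      by (simp add: w_eq U33_mat_mult U33_mat_eq_iff add_divide_distrib diff_divide_distrib)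
    moreover have "U33_mat (- Y) (- Y') 0 0 0 0 \<in> integral_points (U33_bar ?n)"
      using i i' by (auto simp: integral_U33_mat_iff U33_bar_n_ab)
    ultimately show ?thesis
      using i i' by (intro exI[of _ i] exI[of _ i']) auto
  qed
  show ?thesis
    by (rule bruhat_reps_pairI)
      (rule n_ab_in_SO33 U33_mat_in_U33 | (rule integral unique cover; assumption)
        | (simp only: U33_bar_n_ab, blast))+
qed

text \<open>
  As before, the second row determines the entry \<open>x' y/P\<close> of the left factor and the first row the
  other two. The entry in the third column of the first row fixes the last of them as \<open>x' l/P\<close>, where
  \<open>l = (y' y - 1)/D\<close>, up to integers.
\<close>

lemma n_ba_integral_product:
  fixes x x' y y' k l P D :: "'p::prime_card padic"
  assumes "x' * x = 1 + P * k" "y' * y = 1 + D * l"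
    and "P * D = p_pow r" "P = p_pow s"
  shows "U33_mat (y' / D) (x' * (y' * y - 1) / (P * D)) 0 0 (x' * y / P) 0 ** n_ba r s
      ** U33_mat 0 (y / (P * D)) 0 0 (- x / P) 0 = vector
    [vector [- y', - (l * x'), l * k, 0, 0, 0],
     vector [- D, - (x' * y), y * k, 0, 0, 0],
     vector [0, - P, x, 0, 0, 0],
     vector [0, 0, 0, - y, D * x, P * D],
     vector [0, 0, 0, l, - (y' * x), - (y' * P)],
     vector [0, 0, 0, 0, k, x']]"
proof -
  have nz: "P \<noteq> 0" "D \<noteq> 0"
    using assms(3,4) p_pow_nonzero[of r, where 'p = 'p] p_pow_nonzero[of s, where 'p = 'p] by auto
  have k: "k = (x' * x - 1) / P" and l: "l = (y' * y - 1) / D"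
    using assms(1,2) nz by (simp_all add: field_simps)
  show ?thesis
    unfolding k l
    by (simp add: n_ba_entries U33_mat_def vector_mult_6 vector_6_eq_iff p_pow_simps nz field_simps
        flip: assms(3,4))
qed

text \<open>
  The roles of the two rows are exchanged: the third row of \<open>g\<close> makes \<open>p ^ s x\<close> a unit modulo
  \<open>p ^ s\<close>, and the fourth row makes \<open>p ^ r y\<close> a unit modulo \<open>p ^ (r - s)\<close>.
\<close>

lemma bruhat_reps_n_ba:
  assumes rs: "s \<le> r"
  shows "bruhat_reps (n_ba (int r) (int s) :: 'p::prime_card padic ^ 6 ^ 6) (kl_S3_indices TYPE('p) s r)
     (\<lambda>(x, y). U33_mat (of_int (modular_inverse (int CARD('p) ^ (r - s)) y) / pp ^ (r - s))
        (of_int (modular_inverse (int CARD('p) ^ s) x)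
          * (of_int (modular_inverse (int CARD('p) ^ (r - s)) y) * of_int y - 1) / pp ^ r) 0 0
        (of_int (modular_inverse (int CARD('p) ^ s) x) * of_int y / pp ^ s) 0)
     (\<lambda>(x, y). U33_mat 0 (of_int y / pp ^ r) 0 0 (- of_int x / pp ^ s) 0)"
proof -
  let ?P = "int CARD('p) ^ s" and ?D = "int CARD('p) ^ (r - s)" and ?n = "n_ba (int r) (int s) :: 'p padic ^ 6 ^ 6"
  let ?I = "kl_S3_indices TYPE('p) s r"
  let ?b = "\<lambda>x y. U33_mat 0 (of_int y / pp ^ r) 0 0 (- of_int x / pp ^ s) 0 :: 'p padic ^ 6 ^ 6"
  have PD: "pp ^ r = pp ^ s * (pp ^ (r - s) :: 'p padic)"
    using rs by (simp flip: power_add)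
  have integral: "integral_mat (U33_mat (of_int (modular_inverse ?D y) / pp ^ (r - s))
      (of_int (modular_inverse ?P x) * (of_int (modular_inverse ?D y) * of_int y - 1) / pp ^ r) 0 0
      (of_int (modular_inverse ?P x) * of_int y / pp ^ s) 0
      ** ?n ** ?b x y)"
    if "(x, y) \<in> ?I" for x y
  proof -
    have xy: "coprime x ?P" "coprime y ?D"
      using that by simp_all
    obtain k where k: "of_int (modular_inverse ?P x) * of_int x = 1 + pp ^ s * (of_int k :: 'p padic)"
      using inverse_witness[OF xy(1)] .
    obtain l where l: "of_int (modular_inverse ?D y) * of_int y = 1 + pp ^ (r - s) * (of_int l :: 'p padic)"
      using inverse_witness[OF xy(2)] .
    from n_ba_integral_product[OF k l, of "int r" "int s", unfolded p_pow_of_nat, OF PD[symmetric] refl] show ?thesis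
      by (simp add: integral_mat_def forall_6 PD)
  qed
  have unique: "i = j \<and> i' = j'" if ij: "(i, i') \<in> ?I" "(j, j') \<in> ?I"
    "k \<in> integral_points (U33_bar ?n)" "?b j j' = ?b i i' ** k" for i i' j j' k
  proof -
    obtain x y where k: "k = U33_mat 0 y 0 0 x 0"
      using ij(3) by (auto simp: integral_points_iff U33_bar_n_ba)
    then have "x \<in> padic_ints" "y \<in> padic_ints"
      using ij(3) by (simp_all add: integral_U33_mat_iff)
    moreover have "x = - of_int j / pp ^ s - - of_int i / pp ^ s" "y = of_int j' / pp ^ r - of_int i' / pp ^ r"
      using ij(4) by (simp_all add: k U33_mat_mult U33_mat_eq_iff)
    then have "(of_int i - of_int j) / pp ^ s = x" "(of_int j' - of_int i') / pp ^ r = y"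
      by (simp_all add: diff_divide_distrib)
    ultimately show ?thesis
      using ij(1,2) residue_unique[of i j s, where 'p = 'p] residue_unique[of j' i' r, where 'p = 'p] by auto
  qed
  have cover: "\<exists>x y. (x, y) \<in> ?I \<and> (\<exists>k\<in>integral_points (U33_bar ?n). w = ?b x y ** k)"
    if u: "u \<in> U33" and w: "w \<in> U33_bar ?n" and int: "integral_mat (u ** ?n ** w)" for u w
  proof -
    obtain a b z t c f where u_eq: "u = U33_mat a b z t c f"
      using u by (auto simp: U33_def)
    obtain x y where w_eq: "w = U33_mat 0 y 0 0 x 0"
      using w by (auto simp: U33_bar_n_ba)
    define g where "g = u ** ?n ** w"
    have g_int: "g $ i $ j \<in> padic_ints" for i j
      using int by (simp add: g_def integral_mat_def)
    have g: "g $ 4 $ 1 = 0" "g $ 4 $ 2 = 0" "g $ 4 $ 3 = 0" "g $ 4 $ 4 = - (pp ^ r * y)"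
        "g $ 4 $ 5 = - (pp ^ r * x)" "g $ 4 $ 6 = pp ^ r"
        "g $ 3 $ 1 = 0" "g $ 3 $ 2 = - (pp ^ s)" "g $ 3 $ 3 = - (pp ^ s * x)"
        "g $ 6 $ 1 = 0" "g $ 6 $ 2 = 0" "g $ 6 $ 3 = 0"
      by (simp_all add: g_def u_eq w_eq matrix_mult_6)
         (simp_all add: n_ba_entries U33_mat_def p_pow_simps p_pow_of_nat)
    note pairing = SO33_pairing[OF U33_mult_n_bar_in_SO33[OF u n_ba_in_SO33 w], folded g_def]
    have "1 = pp ^ s * (- g $ 6 $ 5) + - (pp ^ s * x) * g $ 6 $ 6"
      using pairing[of 3 6] by (simp add: g SO33_form_def)
    then obtain i Y where i: "i \<in> {0..<?P}" "coprime i ?P" "Y \<in> padic_ints"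
        "- (pp ^ s * x) = of_int i + pp ^ s * Y"
      by (rule coprime_residueE[where k = s]) (use g_int[of 3 3] g_int in \<open>auto simp: g\<close>)
    \<comment> \<open>In row 4 the entry \<open>- p ^ r x\<close> in column 5 is \<open>p ^ (r - s)\<close> times the integral entry of row 3 in column 3.\<close>
    have "1 = pp ^ (r - s) * (pp ^ s * g $ 1 $ 3 + g $ 3 $ 3 * g $ 1 $ 2) + pp ^ r * y * (- g $ 1 $ 1)"
      using pairing[of 4 1] by (simp add: g SO33_form_def PD algebra_simps)
    then obtain i' Y' where i': "i' \<in> {0..<int CARD('p) ^ r}" "coprime i' ?D" "Y' \<in> padic_ints"
        "pp ^ r * y = of_int i' + pp ^ r * Y'"
      by (rule coprime_residueE[where k = r]) (use g_int[of 3 3] g_int[of 4 4] g_int in \<open>auto simp: g\<close>)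
    have "x = - (of_int i + pp ^ s * Y) / pp ^ s" "y = (of_int i' + pp ^ r * Y') / pp ^ r"
      by (simp_all flip: i(4) i'(4))
    then have "w = ?b i i' ** U33_mat 0 Y' 0 0 (- Y) 0"
      by (simp add: w_eq U33_mat_mult U33_mat_eq_iff add_divide_distrib diff_divide_distrib)
    moreover have "U33_mat 0 Y' 0 0 (- Y) 0 \<in> integral_points (U33_bar ?n)"
      using i i' by (auto simp: integral_U33_mat_iff U33_bar_n_ba)
    ultimately show ?thesis
      using i i' by (intro exI[of _ i] exI[of _ i']) auto
  qed
  show ?thesis
    by (rule bruhat_reps_pairI)
      (rule n_ba_in_SO33 U33_mat_in_U33 | (rule integral unique cover; assumption)
        | (simp only: U33_bar_n_ba, blast))+
qed

text \<open>
  The roots \<open>\<alpha>\<close> and \<open>\<gamma>\<close> are orthogonal, so their copies of \<open>SL_2\<close> commute and act on the coordinates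
  2, 3, 5, 6 as a tensor product. Up to sign the entries are products of an entry of
  \<open>(-x', -k; -P, -x)\<close> and an entry of \<open>(-y', -l; -R, -y)\<close>.
\<close>

lemma n_ac_integral_product:
  fixes x x' y y' k l P R :: "'p::prime_card padic"
  assumes "x' * x = 1 + P * k" "y' * y = 1 + R * l"
    and "R = p_pow r" "P = p_pow s"
  shows "U33_mat 0 0 0 0 (x' / P) (y' / R) ** n_ac r s ** U33_mat 0 0 0 0 (x / P) (y / R) = vector
    [vector [1, 0, 0, 0, 0, 0],
     vector [0, x' * y', y' * k, 0, - (k * l), x' * l],
     vector [0, y' * P, y' * x, 0, - (x * l), P * l],
     vector [0, 0, 0, 1, 0, 0],
     vector [0, - (P * R), - (R * x), 0, x * y, - (P * y)],
     vector [0, x' * R, R * k, 0, - (k * y), x' * y]]"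
proof -
  have nz: "P \<noteq> 0" "R \<noteq> 0"
    using assms(3,4) by auto
  have k: "k = (x' * x - 1) / P" and l: "l = (y' * y - 1) / R"
    using assms(1,2) nz by (simp_all add: field_simps)
  show ?thesis
    unfolding k l
    by (simp add: n_ac_entries U33_mat_def vector_mult_6 vector_6_eq_iff p_pow_simps nz field_simps
        flip: assms(3,4))
qed

text \<open>
  The rows of \<open>g\<close> mix the two parameters, but the exterior square of a tensor product of two planes
  separates them. The minors of the third and fifth row are \<open>p ^ (2 s)\<close> times \<open>1\<close>, \<open>x\<close>, \<open>x ^ 2\<close>, those
  of the fifth and sixth row are \<open>p ^ (2 r)\<close> times \<open>1\<close>, \<open>y\<close>, \<open>y ^ 2\<close>, up to sign. The last ones
  show that \<open>p ^ s x\<close> and \<open>p ^ r y\<close> are integral. That their vectors of minors are primitive makes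
  these numbers units modulo \<open>p ^ s\<close> and \<open>p ^ r\<close>.
\<close>

lemma bruhat_reps_n_ac:
  "bruhat_reps (n_ac (int r) (int s) :: 'p::prime_card padic ^ 6 ^ 6)
     (unit_residues TYPE('p) s \<times> unit_residues TYPE('p) r)
     (\<lambda>(x, y). U33_mat 0 0 0 0 (of_int (modular_inverse (int CARD('p) ^ s) x) / pp ^ s)
        (of_int (modular_inverse (int CARD('p) ^ r) y) / pp ^ r))
     (\<lambda>(x, y). U33_mat 0 0 0 0 (of_int x / pp ^ s) (of_int y / pp ^ r))"
proof -
  let ?P = "int CARD('p) ^ s" and ?R = "int CARD('p) ^ r" and ?n = "n_ac (int r) (int s) :: 'p padic ^ 6 ^ 6"
  let ?I = "unit_residues TYPE('p) s \<times> unit_residues TYPE('p) r"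
  let ?b = "\<lambda>x y. U33_mat 0 0 0 0 (of_int x / pp ^ s) (of_int y / pp ^ r) :: 'p padic ^ 6 ^ 6"
  have integral: "integral_mat (U33_mat 0 0 0 0 (of_int (modular_inverse ?P x) / pp ^ s)
      (of_int (modular_inverse ?R y) / pp ^ r) ** ?n ** ?b x y)"
    if "(x, y) \<in> ?I" for x y
  proof -
    have xy: "coprime x ?P" "coprime y ?R"
      using that by simp_all
    obtain k where k: "of_int (modular_inverse ?P x) * of_int x = 1 + pp ^ s * (of_int k :: 'p padic)"
      using inverse_witness[OF xy(1)] .
    obtain l where l: "of_int (modular_inverse ?R y) * of_int y = 1 + pp ^ r * (of_int l :: 'p padic)"
      using inverse_witness[OF xy(2)] .
    from n_ac_integral_product[OF k l, of "int r" "int s", unfolded p_pow_of_nat, OF refl refl] show ?thesis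
      by (simp add: integral_mat_def forall_6)
  qed
  have unique: "i = j \<and> i' = j'" if ij: "(i, i') \<in> ?I" "(j, j') \<in> ?I"
    "k \<in> integral_points (U33_bar ?n)" "?b j j' = ?b i i' ** k" for i i' j j' k
  proof -
    obtain x y where k: "k = U33_mat 0 0 0 0 x y"
      using ij(3) by (auto simp: integral_points_iff U33_bar_n_ac)
    then have "x \<in> padic_ints" "y \<in> padic_ints"
      using ij(3) by (simp_all add: integral_U33_mat_iff)
    moreover have "(of_int j - of_int i) / pp ^ s = x" "(of_int j' - of_int i') / pp ^ r = y"
      using ij(4) by (simp_all add: k U33_mat_mult U33_mat_eq_iff diff_divide_distrib)
    ultimately show ?thesis
      using ij(1,2) residue_unique[of j i s, where 'p = 'p] residue_unique[of j' i' r, where 'p = 'p] by auto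
  qed
  have cover: "\<exists>x y. (x, y) \<in> ?I \<and> (\<exists>k\<in>integral_points (U33_bar ?n). w = ?b x y ** k)"
    if u: "u \<in> U33" and w: "w \<in> U33_bar ?n" and int: "integral_mat (u ** ?n ** w)" for u w
  proof -
    obtain a b z t c f where u_eq: "u = U33_mat a b z t c f"
      using u by (auto simp: U33_def)
    obtain x y where w_eq: "w = U33_mat 0 0 0 0 x y"
      using w by (auto simp: U33_bar_n_ac)
    define g where "g = u ** ?n ** w"
    define P R :: "'p padic" where "P = pp ^ s" and "R = pp ^ r"
    have nz: "P \<noteq> 0" "R \<noteq> 0"
      by (simp_all add: P_def R_def)
    have g_int: "g $ i $ j \<in> padic_ints" for i j
      using int by (simp add: g_def integral_mat_def)
    have g: "g $ 2 $ 1 = 0" "g $ 3 $ 1 = 0" "g $ 5 $ 1 = 0" "g $ 6 $ 1 = 0"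
        "g $ 5 $ 2 = - (P * R)" "g $ 5 $ 3 = - (P * R * x)" "g $ 5 $ 5 = P * R * x * y" "g $ 5 $ 6 = - (P * R * y)"
        "g $ 3 $ 2 = f * P * R" "g $ 3 $ 3 = f * P * R * x"
        "g $ 3 $ 5 = P * x / R - f * P * R * x * y" "g $ 3 $ 6 = - P / R + f * P * R * y"
        "g $ 6 $ 2 = c * P * R" "g $ 6 $ 3 = - R / P + c * P * R * x"
        "g $ 6 $ 5 = R * y / P - c * P * R * x * y" "g $ 6 $ 6 = c * P * R * y"
      unfolding P_def R_def
      by (simp_all add: g_def u_eq w_eq matrix_mult_6)
         (simp_all add: n_ac_entries U33_mat_def p_pow_simps p_pow_of_nat)
    have pairing: "- (P * R * g $ 2 $ 5) - P * R * x * g $ 2 $ 6 + P * R * x * y * g $ 2 $ 2 - P * R * y * g $ 2 $ 3 = 1"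
      using SO33_pairing[OF U33_mult_n_bar_in_SO33[OF u n_ac_in_SO33 w], of 5 2, folded g_def]
      by (simp add: g SO33_form_def algebra_simps)
    define X Y where "X = P * x" and "Y = R * y"
    \<comment> \<open>The minor of rows 3 and 5 in columns 3 and 5.\<close>
    have "g $ 3 $ 3 * g $ 5 $ 5 - g $ 3 $ 5 * g $ 5 $ 3 = (P * R * x / pp ^ r) ^ 2"
      unfolding R_def[symmetric] by (simp add: g nz field_simps power2_eq_square)
    then have "(P * R * x / pp ^ r) ^ 2 \<in> padic_ints"
      by (metis padic_ints_diff padic_ints_mult g_int)
    then have "P * R * x / pp ^ r \<in> padic_ints"
      by (rule padic_ints_quotient_root) (use g_int[of 5 3] in \<open>simp add: g\<close>)
    then have X: "X \<in> padic_ints"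
      by (simp add: X_def R_def)
    \<comment> \<open>The minor of rows 5 and 6 in columns 5 and 6.\<close>
    have "g $ 5 $ 5 * g $ 6 $ 6 - g $ 5 $ 6 * g $ 6 $ 5 = (P * R * y / pp ^ s) ^ 2"
      unfolding P_def[symmetric] by (simp add: g nz field_simps power2_eq_square)
    then have "(P * R * y / pp ^ s) ^ 2 \<in> padic_ints"
      by (metis padic_ints_diff padic_ints_mult g_int)
    then have "P * R * y / pp ^ s \<in> padic_ints"
      by (rule padic_ints_quotient_root) (use g_int[of 5 6] in \<open>simp add: g\<close>)
    then have Y: "Y \<in> padic_ints"
      by (simp add: Y_def P_def)
    have PR: "P \<in> padic_ints" "R \<in> padic_ints"
      by (simp_all add: P_def R_def padic_ints_power)
    \<comment> \<open>The Laplace expansion of the pairing of rows 3, 5 with the dual rows 6, 2, as a multiple of \<open>P\<close> plus a multiple of \<open>X\<close>.\<close>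
    have "P * (g $ 6 $ 3 * (P * g $ 2 $ 5 + X * g $ 2 $ 6) - (P * g $ 6 $ 5 + X * g $ 6 $ 6) * g $ 2 $ 3)
        + X * ((P * g $ 6 $ 5 + X * g $ 6 $ 6) * g $ 2 $ 2 - g $ 6 $ 2 * (P * g $ 2 $ 5 + X * g $ 2 $ 6))
      = - (P * R * g $ 2 $ 5) - P * R * x * g $ 2 $ 6 + P * R * x * y * g $ 2 $ 2 - P * R * y * g $ 2 $ 3"
      by (simp add: g X_def nz field_simps)
    then have "1 = pp ^ s * (g $ 6 $ 3 * (P * g $ 2 $ 5 + X * g $ 2 $ 6) - (P * g $ 6 $ 5 + X * g $ 6 $ 6) * g $ 2 $ 3)
        + X * ((P * g $ 6 $ 5 + X * g $ 6 $ 6) * g $ 2 $ 2 - g $ 6 $ 2 * (P * g $ 2 $ 5 + X * g $ 2 $ 6))"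
      unfolding P_def[symmetric] pairing by (rule sym)
    then obtain i Y1 where i: "i \<in> {0..<?P}" "coprime i ?P" "Y1 \<in> padic_ints" "X = of_int i + pp ^ s * Y1"
      by (rule coprime_residueE[where k = s])
        (intro order_refl padic_ints_add padic_ints_diff padic_ints_mult X PR g_int)+
    \<comment> \<open>The same for the pairing of rows 6, 5 with the dual rows 3, 2.\<close>
    have "R * (g $ 3 $ 6 * (R * g $ 2 $ 5 + Y * g $ 2 $ 3) - (R * g $ 3 $ 5 + Y * g $ 3 $ 3) * g $ 2 $ 6)
        + Y * ((R * g $ 3 $ 5 + Y * g $ 3 $ 3) * g $ 2 $ 2 - g $ 3 $ 2 * (R * g $ 2 $ 5 + Y * g $ 2 $ 3))
      = - (P * R * g $ 2 $ 5) - P * R * x * g $ 2 $ 6 + P * R * x * y * g $ 2 $ 2 - P * R * y * g $ 2 $ 3"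
      by (simp add: g Y_def nz field_simps)
    then have "1 = pp ^ r * (g $ 3 $ 6 * (R * g $ 2 $ 5 + Y * g $ 2 $ 3) - (R * g $ 3 $ 5 + Y * g $ 3 $ 3) * g $ 2 $ 6)
        + Y * ((R * g $ 3 $ 5 + Y * g $ 3 $ 3) * g $ 2 $ 2 - g $ 3 $ 2 * (R * g $ 2 $ 5 + Y * g $ 2 $ 3))"
      unfolding R_def[symmetric] pairing by (rule sym)
    then obtain i' Y2 where i': "i' \<in> {0..<?R}" "coprime i' ?R" "Y2 \<in> padic_ints" "Y = of_int i' + pp ^ r * Y2"
      by (rule coprime_residueE[where k = r])
        (intro order_refl padic_ints_add padic_ints_diff padic_ints_mult Y PR g_int)+
    have "x = (of_int i + pp ^ s * Y1) / pp ^ s" "y = (of_int i' + pp ^ r * Y2) / pp ^ r"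
      unfolding i(4)[symmetric] i'(4)[symmetric] by (simp_all add: X_def Y_def P_def R_def)
    then have "w = ?b i i' ** U33_mat 0 0 0 0 Y1 Y2"
      by (simp add: w_eq U33_mat_mult U33_mat_eq_iff add_divide_distrib)
    moreover have "U33_mat 0 0 0 0 Y1 Y2 \<in> integral_points (U33_bar ?n)"
      using i i' by (auto simp: integral_U33_mat_iff U33_bar_n_ac)
    ultimately show ?thesis
      using i i' by (intro exI[of _ i] exI[of _ i']) auto
  qed
  show ?thesis
    by (rule bruhat_reps_pairI)
      (rule n_ac_in_SO33 U33_mat_in_U33 | (rule integral unique cover; assumption)
        | (simp only: U33_bar_n_ac, blast))+
qed

section \<open>The symmetry exchanging the third and the sixth coordinate\<close>

text \<open>
  Conjugating the left factors by \<open>P\<close> and the right factors by \<open>Q\<close> transports representatives of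
  \<open>n\<close> to representatives of \<open>P n Q\<close>. Orthogonality of \<open>P\<close> and \<open>Q\<close> lets the inverse be written as the
  transpose, so that preserving \<open>U33\<close> also means preserving the opposite group.
\<close>

lemma bruhat_reps_transport:
  fixes n P Q :: "'p::prime_card padic ^ 6 ^ 6"
  assumes reps: "bruhat_reps n I a b" and PnQ: "P ** n ** Q \<in> SO33"
    and P: "integral_mat P" "P ** transpose P = mat 1" "transpose P ** P = mat 1"
    and Q: "integral_mat Q" "Q ** transpose Q = mat 1" "transpose Q ** Q = mat 1"
    and PU: "\<And>A. A \<in> U33 \<Longrightarrow> P ** A ** transpose P \<in> U33" "\<And>A. A \<in> U33 \<Longrightarrow> transpose P ** A ** P \<in> U33"
    and QU: "\<And>A. A \<in> U33 \<Longrightarrow> transpose Q ** A ** Q \<in> U33" "\<And>A. A \<in> U33 \<Longrightarrow> Q ** A ** transpose Q \<in> U33"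
  shows "bruhat_reps (P ** n ** Q) I (\<lambda>i. P ** a i ** transpose P) (\<lambda>i. transpose Q ** b i ** Q)"
proof -
  have cancel: "B ** P ** transpose P = B" "B ** transpose P ** P = B"
    "B ** Q ** transpose Q = B" "B ** transpose Q ** Q = B" for B
    using P(2,3) Q(2,3) by (simp_all flip: matrix_mul_assoc)
  have QP_int: "integral_mat (transpose Q)" "integral_mat (transpose P)"
    using P(1) Q(1) by (simp_all add: integral_mat_def transpose_entry)
  have n: "n \<in> SO33"
    using reps by (simp add: bruhat_reps_def)
  let ?f = "\<lambda>w. transpose Q ** w ** Q"
  have bar: "?f w \<in> U33_bar (P ** n ** Q)" if w: "w \<in> U33_bar n" for w
  proof -
    obtain c where c: "c \<in> U33" "n ** w = transpose c ** n" "w \<in> U33"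
      using w by (auto simp: U33_bar_iff[OF n])
    have "P ** n ** Q ** ?f w = P ** (n ** w) ** Q"
      by (simp add: matrix_mul_assoc cancel)
    also have "\<dots> = transpose (P ** c ** transpose P) ** (P ** n ** Q)"
      by (simp add: c matrix_transpose_mul transpose_transpose matrix_mul_assoc cancel)
    finally show ?thesis
      using c PU QU by (auto simp: U33_bar_iff[OF PnQ])
  qed
  have bar': "Q ** w ** transpose Q \<in> U33_bar n" if w: "w \<in> U33_bar (P ** n ** Q)" for w
  proof -
    obtain c where c: "c \<in> U33" "P ** n ** Q ** w = transpose c ** (P ** n ** Q)" "w \<in> U33"
      using w by (auto simp: U33_bar_iff[OF PnQ])
    have "n ** (Q ** w ** transpose Q) = transpose P ** (P ** n ** Q ** w) ** transpose Q"
      by (simp add: matrix_mul_assoc P(3))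
    also have "\<dots> = transpose (transpose P ** c ** P) ** n"
      by (simp add: c(2) matrix_transpose_mul transpose_transpose matrix_mul_assoc cancel)
    finally show ?thesis
      using c PU QU by (auto simp: U33_bar_iff[OF n])
  qed
  have ff: "?f (Q ** w ** transpose Q) = w" "Q ** ?f w ** transpose Q = w" for w
    using Q(2,3) by (simp_all add: matrix_mul_assoc cancel)
  have f_mult: "?f (v ** w) = ?f v ** ?f w" for v w
    by (simp add: matrix_mul_assoc cancel)
  have int_bar: "?f k \<in> integral_points (U33_bar (P ** n ** Q))" if "k \<in> integral_points (U33_bar n)" for k
  proof -
    have k: "k \<in> U33_bar n" "integral_mat k"
      using that by (simp_all add: integral_points_iff)
    have "?f k \<in> U33"
      using bar[OF k(1)] by (simp add: U33_bar_def)
    then show ?thesis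
      using bar[OF k(1)] k(2) Q(1) QP_int U33_in_SO33 by (simp add: integral_points_iff integral_mat_mult)
  qed
  have int_bar': "Q ** k ** transpose Q \<in> integral_points (U33_bar n)"
    if "k \<in> integral_points (U33_bar (P ** n ** Q))" for k
  proof -
    have k: "k \<in> U33_bar (P ** n ** Q)" "integral_mat k"
      using that by (simp_all add: integral_points_iff)
    have "Q ** k ** transpose Q \<in> U33"
      using bar'[OF k(1)] by (simp add: U33_bar_def)
    then show ?thesis
      using bar'[OF k(1)] k(2) Q(1) QP_int U33_in_SO33 by (simp add: integral_points_iff integral_mat_mult)
  qed
  have ab: "i \<in> I \<Longrightarrow> a i \<in> U33" "i \<in> I \<Longrightarrow> b i \<in> U33_bar n"
      "i \<in> I \<Longrightarrow> integral_mat (a i ** n ** b i)"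
    and unique: "\<lbrakk>i \<in> I; j \<in> I; k \<in> integral_points (U33_bar n); b j = b i ** k\<rbrakk> \<Longrightarrow> i = j"
    and cover: "\<lbrakk>u \<in> U33; w \<in> U33_bar n; integral_mat (u ** n ** w)\<rbrakk> \<Longrightarrow>
      \<exists>i\<in>I. \<exists>k\<in>integral_points (U33_bar n). w = b i ** k" for i j k u w
    using reps unfolding bruhat_reps_def by blast+
  show ?thesis
    unfolding bruhat_reps_def
  proof (intro conjI ballI impI PnQ)
    fix i assume i: "i \<in> I"
    show "P ** a i ** transpose P \<in> U33" "?f (b i) \<in> U33_bar (P ** n ** Q)"
      using ab[OF i] PU bar by blast+
    have "P ** a i ** transpose P ** (P ** n ** Q) ** ?f (b i) = P ** (a i ** n ** b i) ** Q"
      by (simp add: matrix_mul_assoc cancel)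
    then show "integral_mat (P ** a i ** transpose P ** (P ** n ** Q) ** ?f (b i))"
      using ab(3)[OF i] P(1) Q(1) by (simp only: integral_mat_mult)
  next
    fix i j k assume ij: "i \<in> I" "j \<in> I" and k: "k \<in> integral_points (U33_bar (P ** n ** Q))"
      and eq: "?f (b j) = ?f (b i) ** k"
    have "b j = Q ** ?f (b j) ** transpose Q"
      by (simp only: ff)
    also have "\<dots> = b i ** (Q ** k ** transpose Q)"
      using Q(2) by (simp add: eq matrix_mul_assoc)
    finally show "i = j"
      using unique ij int_bar'[OF k] by blast
  next
    fix u w assume u: "u \<in> U33" and w: "w \<in> U33_bar (P ** n ** Q)"
      and int: "integral_mat (u ** (P ** n ** Q) ** w)"
    have "transpose P ** u ** P ** n ** (Q ** w ** transpose Q)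
        = transpose P ** (u ** (P ** n ** Q) ** w) ** transpose Q"
      by (simp add: matrix_mul_assoc)
    then have "integral_mat (transpose P ** u ** P ** n ** (Q ** w ** transpose Q))"
      using int QP_int by (simp only: integral_mat_mult)
    then obtain i k where ik: "i \<in> I" "k \<in> integral_points (U33_bar n)" "Q ** w ** transpose Q = b i ** k"
      using cover[OF PU(2)[OF u] bar'[OF w]] by blast
    have "w = ?f (b i) ** ?f k"
      using ff(1)[of w] f_mult[of "b i" k] by (simp only: ik)
    then show "\<exists>i\<in>I. \<exists>k\<in>integral_points (U33_bar (P ** n ** Q)). w = ?f (b i) ** k"
      using ik int_bar by blast
  qed
qed

text \<open>
  The exchange of the coordinates 3 and 6, which induces the outer automorphism, multiplied by an
  element of the torus with entries \<open>1\<close> and \<open>-1\<close>.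
\<close>

definition signed_swap :: "'a::comm_ring_1 \<Rightarrow> 'a \<Rightarrow> 'a \<Rightarrow> 'a ^ 6 ^ 6" where
  "signed_swap a b c = vector
    [vector [a, 0, 0, 0, 0, 0],
     vector [0, b, 0, 0, 0, 0],
     vector [0, 0, 0, 0, 0, c],
     vector [0, 0, 0, a, 0, 0],
     vector [0, 0, 0, 0, b, 0],
     vector [0, 0, c, 0, 0, 0]]"

lemma mat_1_vector_6:
  "(mat 1 :: 'a::comm_ring_1 ^ 6 ^ 6) = vector
    [vector [1, 0, 0, 0, 0, 0],
     vector [0, 1, 0, 0, 0, 0],
     vector [0, 0, 1, 0, 0, 0],
     vector [0, 0, 0, 1, 0, 0],
     vector [0, 0, 0, 0, 1, 0],
     vector [0, 0, 0, 0, 0, 1]]"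
  unfolding vec_eq_iff forall_6 by (simp add: mat_def)

lemma signed_swap_orthogonal:
  assumes "a \<in> {1, -1}" "b \<in> {1, -1}" "c \<in> {1, -1}"
  shows "signed_swap a b c ** transpose (signed_swap a b c) = mat 1"
    and "transpose (signed_swap a b c) ** signed_swap a b c = mat 1"
  using assms by (auto simp: signed_swap_def transpose_vector_6 vector_mult_6 mat_1_vector_6)

lemma signed_swap_conj:
  assumes "a \<in> {1, -1}" "b \<in> {1, -1}" "c \<in> {1, -1}"
  shows "signed_swap a b c ** U33_mat x y z t u v ** transpose (signed_swap a b c)
      = U33_mat (a * b * x) (a * c * t) (a * b * z) (a * c * y) (b * c * v) (b * c * u)"
    and "transpose (signed_swap a b c) ** U33_mat x y z t u v ** signed_swap a b c
      = U33_mat (a * b * x) (a * c * t) (a * b * z) (a * c * y) (b * c * v) (b * c * u)"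
  using assms
  by (elim insertE emptyE;
      simp add: signed_swap_def U33_mat_def transpose_vector_6 vector_mult_6 vector_6_eq_iff algebra_simps)+

lemma signed_swap_conj_U33:
  assumes "a \<in> {1, -1}" "b \<in> {1, -1}" "c \<in> {1, -1}" "A \<in> U33"
  shows "signed_swap a b c ** A ** transpose (signed_swap a b c) \<in> U33"
    and "transpose (signed_swap a b c) ** A ** signed_swap a b c \<in> U33"
proof -
  obtain x y z t u v where A: "A = U33_mat x y z t u v"
    using assms(4) by (auto simp: U33_def)
  show "signed_swap a b c ** A ** transpose (signed_swap a b c) \<in> U33"
    "transpose (signed_swap a b c) ** A ** signed_swap a b c \<in> U33"
    by (simp_all only: A signed_swap_conj[OF assms(1-3)] U33_mat_in_U33)
qed

lemma signed_swap_form: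
  assumes "a \<in> {1, -1}" "b \<in> {1, -1}" "c \<in> {1, -1}"
  shows "signed_swap a b c ** SO33_form ** transpose (signed_swap a b c) = SO33_form"
  using assms
  by (auto simp: signed_swap_def SO33_form_def transpose_vector_6 vector_mult_6)

lemma det_signed_swap:
  fixes a b c :: "'a::comm_ring_1"
  assumes "a \<in> {1, -1}" "b \<in> {1, -1}" "c \<in> {1, -1}"
  shows "det (signed_swap a b c) = det (signed_swap 1 1 1)"
proof -
  define D :: "'a ^ 6 ^ 6" where "D = vector
    [vector [a, 0, 0, 0, 0, 0],
     vector [0, b, 0, 0, 0, 0],
     vector [0, 0, c, 0, 0, 0],
     vector [0, 0, 0, a, 0, 0],
     vector [0, 0, 0, 0, b, 0],
     vector [0, 0, 0, 0, 0, c]]"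
  have "signed_swap a b c = signed_swap 1 1 1 ** D"
    by (simp add: signed_swap_def D_def vector_mult_6)
  moreover have "det D = (\<Prod>i\<in>UNIV. D $ i $ i)"
  proof (rule det_diagonal)
    have "\<forall>i j. i \<noteq> j \<longrightarrow> D $ i $ j = 0"
      unfolding forall_6 by (simp add: D_def)
    then show "i \<noteq> j \<Longrightarrow> D $ i $ j = 0" for i j
      by blast
  qed
  moreover have "(\<Prod>i\<in>UNIV. D $ i $ i) = a * b * c * (a * b * c)"
    unfolding UNIV_6 by (simp add: D_def mult.assoc)
  moreover have "a * b * c * (a * b * c) = 1"
    using assms by (elim insertE emptyE) simp_all
  ultimately show ?thesis
    by (simp only: det_mul mult_1_right)
qed

text \<open>
  A single exchange of coordinates has determinant \<open>-1\<close>; it has to occur on both sides of \<open>n\<close>.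
\<close>

lemma signed_swap_in_SO33:
  fixes n :: "'a::field ^ 6 ^ 6"
  assumes "n \<in> SO33" "a \<in> {1, -1}" "b \<in> {1, -1}" "c \<in> {1, -1}"
  shows "signed_swap 1 1 1 ** n ** signed_swap a b c \<in> SO33"
proof -
  let ?S = "signed_swap 1 1 1 :: 'a ^ 6 ^ 6" and ?R = "signed_swap a b c"
  have S: "?S ** SO33_form ** transpose ?S = SO33_form"
    by (rule signed_swap_form) simp_all
  have "?S ** n ** ?R ** SO33_form ** transpose (?S ** n ** ?R)
      = ?S ** (n ** (?R ** SO33_form ** transpose ?R) ** transpose n) ** transpose ?S"
    by (simp add: matrix_transpose_mul matrix_mul_assoc)
  also have "\<dots> = SO33_form"
    using assms(1) S by (simp add: SO33_def signed_swap_form[OF assms(2-4)])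
  finally have "?S ** n ** ?R ** SO33_form ** transpose (?S ** n ** ?R) = SO33_form" .
  moreover have "det (?S ** n ** ?R) = 1"
    using assms(1) det_form_preserving[OF S]
    by (simp add: det_mul det_signed_swap[OF assms(2-4)] SO33_def)
  ultimately show ?thesis
    by (simp add: SO33_def)
qed

lemma bruhat_reps_signed_swap:
  fixes n :: "'p::prime_card padic ^ 6 ^ 6"
  assumes reps: "bruhat_reps n I a b" and signs: "e1 \<in> {1, -1}" "e2 \<in> {1, -1}" "e3 \<in> {1, -1}"
  shows "bruhat_reps (signed_swap 1 1 1 ** n ** signed_swap e1 e2 e3) I
    (\<lambda>i. signed_swap 1 1 1 ** a i ** transpose (signed_swap 1 1 1))
    (\<lambda>i. transpose (signed_swap e1 e2 e3) ** b i ** signed_swap e1 e2 e3)"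
proof (rule bruhat_reps_transport[OF reps])
  show "signed_swap 1 1 1 ** n ** signed_swap e1 e2 e3 \<in> SO33"
    using reps signs by (intro signed_swap_in_SO33) (auto simp: bruhat_reps_def)
  show "integral_mat (signed_swap 1 1 1 :: 'p padic ^ 6 ^ 6)" "integral_mat (signed_swap e1 e2 e3)"
    using signs by (auto simp: integral_mat_def forall_6 signed_swap_def)
qed (use signs in \<open>simp_all add: signed_swap_orthogonal signed_swap_conj_U33\<close>)

text \<open>
  The signs are taken on the right only, so that the left factors, and with them the arguments of
  \<open>\<psi>\<close>, keep their signs.
\<close>

lemma n_c_signed_swap:
  "n_c r = signed_swap 1 1 1 ** n_a r ** (signed_swap 1 (-1) (-1) :: 'p::prime_card padic ^ 6 ^ 6)"
  by (simp add: n_c_entries n_a_entries signed_swap_def vector_mult_6)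

lemma n_bc_signed_swap:
  "n_bc r s = signed_swap 1 1 1 ** n_ba r s ** (signed_swap (-1) (-1) 1 :: 'p::prime_card padic ^ 6 ^ 6)"
  by (simp add: n_bc_entries n_ba_entries signed_swap_def vector_mult_6)

lemma n_cb_signed_swap:
  "n_cb r s = signed_swap 1 1 1 ** n_ab r s ** (signed_swap 1 1 (-1) :: 'p::prime_card padic ^ 6 ^ 6)"
  by (simp add: n_cb_entries n_ab_entries signed_swap_def vector_mult_6)

lemma bruhat_reps_n_c:
  "bruhat_reps (n_c (int r) :: 'p::prime_card padic ^ 6 ^ 6) (unit_residues TYPE('p) r)
     (\<lambda>d. U33_mat 0 0 0 0 0 (of_int (modular_inverse (int CARD('p) ^ r) d) / pp ^ r))
     (\<lambda>d. U33_mat 0 0 0 0 0 (of_int d / pp ^ r))"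
  using bruhat_reps_signed_swap[OF bruhat_reps_n_a[of r, where 'p = 'p], of 1 "-1" "-1"]
  by (simp add: n_c_signed_swap signed_swap_conj)

lemma bruhat_reps_n_bc:
  assumes rs: "s \<le> r"
  shows "bruhat_reps (n_bc (int r) (int s) :: 'p::prime_card padic ^ 6 ^ 6) (kl_S3_indices TYPE('p) s r)
     (\<lambda>(x, y). U33_mat (of_int (modular_inverse (int CARD('p) ^ (r - s)) y) / pp ^ (r - s)) 0 0
        (of_int (modular_inverse (int CARD('p) ^ s) x)
          * (of_int (modular_inverse (int CARD('p) ^ (r - s)) y) * of_int y - 1) / pp ^ r) 0
        (of_int (modular_inverse (int CARD('p) ^ s) x) * of_int y / pp ^ s))
     (\<lambda>(x, y). U33_mat 0 0 0 (- of_int y / pp ^ r) 0 (of_int x / pp ^ s))"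
  using bruhat_reps_signed_swap[OF bruhat_reps_n_ba[OF rs, where 'p = 'p], of "-1" "-1" 1]
  by (simp add: n_bc_signed_swap signed_swap_conj case_prod_unfold)

lemma bruhat_reps_n_cb:
  assumes rs: "r \<le> s"
  shows "bruhat_reps (n_cb (int r) (int s) :: 'p::prime_card padic ^ 6 ^ 6) (kl_S3_indices TYPE('p) r s)
     (\<lambda>(x, y). U33_mat (of_int (modular_inverse (int CARD('p) ^ r) x) * of_int y / pp ^ r) 0 0
        (of_int (modular_inverse (int CARD('p) ^ r) x) / pp ^ s) 0
        (of_int (modular_inverse (int CARD('p) ^ (s - r)) y) / pp ^ (s - r)))
     (\<lambda>(x, y). U33_mat (- of_int x / pp ^ r) 0 0 (of_int y / pp ^ s) 0 0)"
  using bruhat_reps_signed_swap[OF bruhat_reps_n_ab[OF rs, where 'p = 'p], of 1 1 "-1"]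
  by (simp add: n_cb_signed_swap signed_swap_conj case_prod_unfold)

section \<open>Evaluation of the Kloosterman sums\<close>

lemma U33_char_U33_mat:
  "U33_char m1 m2 m3 (U33_mat x y z t u v)
    = e_padic (of_padic_int m1 * x + of_padic_int m2 * u + of_padic_int m3 * v)"
  by (simp add: U33_char_def U33_mat_def)

lemma padic_rational_I: "x \<in> padic_ints \<Longrightarrow> x / pp ^ k \<in> padic_rational"
  unfolding padic_rational_def padic_ints_def by blast

lemma padic_rational_multiple:
  "of_padic_int m * (of_int a / pp ^ k) \<in> padic_rational"
  "of_padic_int m * (of_int a * of_int b / pp ^ k) \<in> padic_rational"
  unfolding times_divide_eq_right
  by (intro padic_rational_I padic_ints_mult of_padic_int_in padic_ints_of_int)+

lemma kl_S_split:
  fixes m n :: "'p::prime_card padic_int"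
  shows "kl_S m n r = (\<Sum>d\<in>unit_residues TYPE('p) r.
     e_padic (of_padic_int m * (of_int (modular_inverse (int CARD('p) ^ r) d) / pp ^ r)) *
     e_padic (of_padic_int n * (of_int d / pp ^ r)))"
  unfolding kl_S_def Let_def
proof (intro sum.cong refl)
  fix d :: int
  let ?d' = "of_int (modular_inverse (int CARD('p) ^ r) d) :: 'p padic"
  have "(of_padic_int m * ?d' + of_padic_int n * of_int d) / of_int (int CARD('p) ^ r)
      = of_padic_int m * (?d' / pp ^ r) + of_padic_int n * (of_int d / pp ^ r)"
    by (simp add: add_divide_distrib)
  then show "e_padic ((of_padic_int m * ?d' + of_padic_int n * of_int d) / of_int (int CARD('p) ^ r))
    = e_padic (of_padic_int m * (?d' / pp ^ r)) * e_padic (of_padic_int n * (of_int d / pp ^ r))"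
    by (simp only: e_padic_add padic_rational_multiple)
qed

lemma kl_S3_split:
  fixes m1 n1 n2 :: "'p::prime_card padic_int"
  shows "kl_S3 m1 n1 n2 r s = (\<Sum>(x, y)\<in>kl_S3_indices TYPE('p) r s.
     e_padic (of_padic_int m1 * (of_int x / pp ^ r)) *
     e_padic (of_padic_int n1 * (of_int (modular_inverse (int CARD('p) ^ r) x) * of_int y / pp ^ r)) *
     e_padic (of_padic_int n2 * (of_int (modular_inverse (int CARD('p) ^ (s - r)) y) / pp ^ (s - r))))"
  unfolding kl_S3_def Let_def sum.cartesian_product
proof (intro sum.cong refl, clarify)
  fix x y :: int
  let ?x' = "of_int (modular_inverse (int CARD('p) ^ r) x) :: 'p padic"
  have "(of_padic_int m1 * of_int x + of_padic_int n1 * ?x' * of_int y) / of_int (int CARD('p) ^ r)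
      = of_padic_int m1 * (of_int x / pp ^ r) + of_padic_int n1 * (?x' * of_int y / pp ^ r)"
    by (simp add: add_divide_distrib mult.assoc)
  then show "e_padic ((of_padic_int m1 * of_int x + of_padic_int n1 * ?x' * of_int y) / of_int (int CARD('p) ^ r)) *
      e_padic (of_padic_int n2 * of_int (modular_inverse (int CARD('p) ^ (s - r)) y) / of_int (int CARD('p) ^ (s - r)))
    = e_padic (of_padic_int m1 * (of_int x / pp ^ r)) *
      e_padic (of_padic_int n1 * (?x' * of_int y / pp ^ r)) *
      e_padic (of_padic_int n2 * (of_int (modular_inverse (int CARD('p) ^ (s - r)) y) / pp ^ (s - r)))"
    by (simp only: e_padic_add padic_rational_multiple) simp
qed

theorem theorem1p3:
  fixes m1 m2 m3 n1 n2 n3 :: "'p::prime_card padic_int"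
    and r s :: nat
    and \<psi> \<psi>' :: "'p padic ^ 6 ^ 6 \<Rightarrow> complex"
  assumes "\<psi> = U33_char m1 m2 m3"
    and "\<psi>' = U33_char n1 n2 n3"
  shows "(kl_sum \<psi> \<psi>' n_id = 1)
     \<and> (kl_sum \<psi> \<psi>' (n_a (int r)) = kl_S m2 n2 r)
     \<and> (kl_sum \<psi> \<psi>' (n_b (int r)) = kl_S m1 n1 r)
     \<and> (kl_sum \<psi> \<psi>' (n_c (int r)) = kl_S m3 n3 r)
     \<and> (r \<le> s \<longrightarrow> kl_sum \<psi> \<psi>' (n_ab (int r) (int s)) = kl_S3 (- n1) m1 m2 r s)
     \<and> (kl_sum \<psi> \<psi>' (n_ac (int r) (int s)) = kl_S m2 n2 s * kl_S m3 n3 r)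
     \<and> (r \<ge> s \<longrightarrow> kl_sum \<psi> \<psi>' (n_ba (int r) (int s)) = kl_S3 (- n2) m2 m1 s r)
     \<and> (r \<ge> s \<longrightarrow> kl_sum \<psi> \<psi>' (n_bc (int r) (int s)) = kl_S3 n3 m3 m1 s r)
     \<and> (r \<le> s \<longrightarrow> kl_sum \<psi> \<psi>' (n_cb (int r) (int s)) = kl_S3 (- n1) m1 m3 r s)"
proof -
  note char_simps = U33_char_U33_mat mult_zero_right add_0_left add_0_right e_padic_add
    padic_rational_multiple
  have "kl_sum \<psi> \<psi>' n_id = 1"
    unfolding assms kl_sum_eq_sum_reps[OF bruhat_reps_n_id] by (simp add: U33_char_U33_mat flip: U33_mat_0)
  moreover have "kl_sum \<psi> \<psi>' (n_a (int r)) = kl_S m2 n2 r"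
    unfolding assms kl_sum_eq_sum_reps[OF bruhat_reps_n_a] kl_S_split by (simp only: char_simps)
  moreover have "kl_sum \<psi> \<psi>' (n_b (int r)) = kl_S m1 n1 r"
    unfolding assms kl_sum_eq_sum_reps[OF bruhat_reps_n_b] kl_S_split by (simp only: char_simps)
  moreover have "kl_sum \<psi> \<psi>' (n_c (int r)) = kl_S m3 n3 r"
    unfolding assms kl_sum_eq_sum_reps[OF bruhat_reps_n_c] kl_S_split by (simp only: char_simps)
  moreover have "kl_sum \<psi> \<psi>' (n_ab (int r) (int s)) = kl_S3 (- n1) m1 m2 r s" if "r \<le> s"
    unfolding assms kl_sum_eq_sum_reps[OF bruhat_reps_n_ab[OF that]] kl_S3_split case_prod_unfold
    by (intro sum.cong refl, simp only: char_simps) (simp add: of_padic_int_hom mult_ac)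
  moreover have "kl_sum \<psi> \<psi>' (n_ac (int r) (int s)) = kl_S m2 n2 s * kl_S m3 n3 r"
    unfolding assms kl_sum_eq_sum_reps[OF bruhat_reps_n_ac] kl_S_split sum_product sum.cartesian_product
      case_prod_unfold
    by (intro sum.cong refl, simp only: char_simps) (simp only: mult_ac)
  moreover have "kl_sum \<psi> \<psi>' (n_ba (int r) (int s)) = kl_S3 (- n2) m2 m1 s r" if "s \<le> r"
    unfolding assms kl_sum_eq_sum_reps[OF bruhat_reps_n_ba[OF that]] kl_S3_split case_prod_unfold
    by (intro sum.cong refl, simp only: char_simps) (simp add: of_padic_int_hom mult_ac)
  moreover have "kl_sum \<psi> \<psi>' (n_bc (int r) (int s)) = kl_S3 n3 m3 m1 s r" if "s \<le> r"
    unfolding assms kl_sum_eq_sum_reps[OF bruhat_reps_n_bc[OF that]] kl_S3_split case_prod_unfold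
    by (intro sum.cong refl, simp only: char_simps) (simp add: of_padic_int_hom mult_ac)
  moreover have "kl_sum \<psi> \<psi>' (n_cb (int r) (int s)) = kl_S3 (- n1) m1 m3 r s" if "r \<le> s"
    unfolding assms kl_sum_eq_sum_reps[OF bruhat_reps_n_cb[OF that]] kl_S3_split case_prod_unfold
    by (intro sum.cong refl, simp only: char_simps) (simp add: of_padic_int_hom mult_ac)
  ultimately show ?thesis
    by blast
qed

end
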